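(* Let $\{\mathcal{G},\Gamma_0,\Gamma_1\}$ be a generalized boundary triple for $\overline{A}=S^*$, where $S$ is a closed symmetric operator in a Hilbert space $\mathcal{H}$, let $A_0=A\upharpoonright\operatorname{Ker}(\Gamma_0)$, and let $\gamma$ and $M$ be the associated $\gamma$-field and Weyl function. Let $B=B^*:\mathcal{G}\to\mathcal{G}$ be a compact operator, $\mathcal{K}$ a Hilbert space, and $B_1:\mathcal{K}\to\mathcal{G}$, $B_2:\mathcal{G}\to\mathcal{K}$ bounded operators such that $B=B_1B_2$. Then the operator $A_B:=A\upharpoonright\operatorname{Ker}(\Gamma_0+B\Gamma_1)$ is self-adjoint in $\mathcal{H}$ and the following holds. (i) For every $w\in\rho(A_0)$ one has $$\operatorname{Ker}(A_B-w)=\gamma(w)B_1\operatorname{Ker}(I+B_2M(w)B_1).$$ In particular, $w\in\sigma_{\mathrm p}(A_B)$ if and only if $0\in\sigma_{\mathrm p}(I+B_2M(w)B_1)$. (ii) For every $w\in\rho(A_0)\setminus\sigma_{\mathrm p}(A_B)$ the operator $I+B_2M(w)B_1:\mathcal{K}\to\mathcal{K}$ is boundedly invertible. (iii) There holds $\rho(A_0)\setminus\sigma_{\mathrm p}(A_B)=\rho(A_0)\cap\rho(A_B)$, and for every $w\in\rho(A_B)\cap\rho(A_0)$ $$(A_B-w)^{-1}=(A_0-w)^{-1}-\gamma(w)B_1\big(I+B_2M(w)B_1\big)^{-1}B_2\gamma(\overline w)^*.$$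
   Context: Inner products are antilinear in the first and linear in the second argument. Definition (generalized boundary triple): let $S$ be a (densely defined) closed symmetric operator in a Hilbert space $\mathcal{H}$ and let $A$ be an operator with $\overline{A}=S^*$. A triple $\{\mathcal{G},\Gamma_0,\Gamma_1\}$ is a generalized boundary triple for $S^*$ if $\mathcal{G}$ is a Hilbert space and $\Gamma_0,\Gamma_1:\operatorname{Dom}(A)\to\mathcal{G}$ are linear maps such that: (a) $A_0:=A\upharpoonright\operatorname{Ker}(\Gamma_0)$ is self-adjoint in $\mathcal{H}$; (b) $\operatorname{Ran}(\Gamma_0)=\mathcal{G}$; (c) $\langle Af,g\rangle_{\mathcal{H}}-\langle f,Ag\rangle_{\mathcal{H}}=\langle\Gamma_1f,\Gamma_0g\rangle_{\mathcal{G}}-\langle\Gamma_0f,\Gamma_1g\rangle_{\mathcal{G}}$ for all $f,g\in\operatorname{Dom}(A)$. For $w\in\rho(A_0)$ one has the direct sum $\operatorname{Dom}(A)=\operatorname{Ker}(\Gamma_0)\dotplus\operatorname{Ker}(A-w)$, so $\Gamma_0\upharpoonright\operatorname{Ker}(A-w)$ is a bijection onto $\mathcal{G}$. The $\gamma$-field and Weyl function are $\gamma(w):=(\Gamma_0\upharpoonright\operatorname{Ker}(A-w))^{-1}:\mathcal{G}\to\mathcal{H}$ and $M(w):=\Gamma_1\gamma(w):\mathcal{G}\to\mathcal{G}$ for $w\in\rho(A_0)$; both are bounded operators. $\sigma_{\mathrm p}$ denotes the set of eigenvalues and $\rho$ the resolvent set. *)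

theory Defs
  imports "HOL-Analysis.Analysis"
begin

text \<open>
  A complex inner product space is a real one carrying a compatible complex structure, so
  that norm, topology and completeness are those of HOL-Analysis. The complex inner
  product is linear in the second argument and antilinear in the first; definiteness is
  inherited from the real inner product, which is its real part.
\<close>

class complex_inner = real_inner +
  fixes scaleC :: "complex \<Rightarrow> 'a \<Rightarrow> 'a"  (infixr "*\<^sub>C" 75)
    and cinner :: "'a \<Rightarrow> 'a \<Rightarrow> complex"
  assumes scaleC_add_right: "c *\<^sub>C (x + y) = c *\<^sub>C x + c *\<^sub>C y"
    and scaleC_add_left: "(c + d) *\<^sub>C x = c *\<^sub>C x + d *\<^sub>C x"
    and scaleC_scaleC: "c *\<^sub>C d *\<^sub>C x = (c * d) *\<^sub>C x"
    and scaleC_of_real: "complex_of_real r *\<^sub>C x = r *\<^sub>R x"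
    and cinner_commute: "cinner x y = cnj (cinner y x)"
    and cinner_add_right: "cinner x (y + z) = cinner x y + cinner x z"
    and cinner_scaleC_right: "cinner x (c *\<^sub>C y) = c * cinner x y"
    and Re_cinner: "Re (cinner x y) = inner x y"

class chilbert_space = complex_inner + banach

instantiation complex :: chilbert_space
begin

definition "scaleC_complex = ((*) :: complex \<Rightarrow> complex \<Rightarrow> complex)"

definition "cinner_complex = (\<lambda>x y :: complex. cnj x * y)"

instance
  by standard
    (simp_all add: scaleC_complex_def cinner_complex_def inner_complex_def scaleR_conv_of_real
      algebra_simps)

end

definition bounded_clinear :: "('a::complex_inner \<Rightarrow> 'b::complex_inner) \<Rightarrow> bool" where
  "bounded_clinear f \<longleftrightarrow> bounded_linear f \<and> (\<forall>c x. f (c *\<^sub>C x) = c *\<^sub>C f x)"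

definition compact_operator :: "('a::complex_inner \<Rightarrow> 'b::complex_inner) \<Rightarrow> bool" where
  "compact_operator f \<longleftrightarrow> bounded_clinear f \<and> compact (closure (f ` cball 0 1))"

definition boundedly_invertible :: "('a::complex_inner \<Rightarrow> 'b::complex_inner) \<Rightarrow> bool" where
  "boundedly_invertible f \<longleftrightarrow> bij f \<and> bounded_clinear (inv f)"

text \<open>For bounded \<open>f\<close> between Hilbert spaces the map described here exists and is unique.\<close>

definition cadjoint :: "('a::complex_inner \<Rightarrow> 'b::complex_inner) \<Rightarrow> 'b \<Rightarrow> 'a" where
  "cadjoint f = (THE g. \<forall>x y. cinner (f x) y = cinner x (g y))"

definition clinear_on :: "'a::complex_inner set \<Rightarrow> ('a \<Rightarrow> 'b::complex_inner) \<Rightarrow> bool" where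
  "clinear_on D f \<longleftrightarrow> (\<forall>x\<in>D. \<forall>y\<in>D. f (x + y) = f x + f y) \<and> (\<forall>c. \<forall>x\<in>D. f (c *\<^sub>C x) = c *\<^sub>C f x)"

text \<open>
  A (possibly unbounded) operator is represented by its graph, so that extension is
  inclusion, closure is topological closure in the product space, and the operator domain
  is \<^const>\<open>Domain\<close>.
\<close>

type_synonym 'a op = "('a \<times> 'a) set"

definition is_operator :: "'a::complex_inner op \<Rightarrow> bool" where
  "is_operator T \<longleftrightarrow> single_valued T \<and> (0, 0) \<in> T
     \<and> (\<forall>f f' g g'. (f, f') \<in> T \<longrightarrow> (g, g') \<in> T \<longrightarrow> (f + g, f' + g') \<in> T)
     \<and> (\<forall>c f f'. (f, f') \<in> T \<longrightarrow> (c *\<^sub>C f, c *\<^sub>C f') \<in> T)"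

definition densely_defined :: "'a::complex_inner op \<Rightarrow> bool" where
  "densely_defined T \<longleftrightarrow> closure (Domain T) = UNIV"

definition op_adjoint :: "'a::complex_inner op \<Rightarrow> 'a op" where
  "op_adjoint T = {(g, h). \<forall>(f, f')\<in>T. cinner f' g = cinner f h}"

definition symmetric_operator :: "'a::complex_inner op \<Rightarrow> bool" where
  "symmetric_operator T \<longleftrightarrow> is_operator T \<and> densely_defined T \<and> T \<subseteq> op_adjoint T"

definition self_adjoint :: "'a::complex_inner op \<Rightarrow> bool" where
  "self_adjoint T \<longleftrightarrow> is_operator T \<and> densely_defined T \<and> T = op_adjoint T"

definition op_restrict :: "'a::complex_inner op \<Rightarrow> 'a set \<Rightarrow> 'a op" where
  "op_restrict T L = {(f, f') \<in> T. f \<in> L}"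

definition op_shift :: "'a::complex_inner op \<Rightarrow> complex \<Rightarrow> 'a op" where
  "op_shift T w = {(f, f' - w *\<^sub>C f) | f f'. (f, f') \<in> T}"

definition op_ker :: "'a::complex_inner op \<Rightarrow> 'a set" where
  "op_ker T = {f. (f, 0) \<in> T}"

definition op_of_fun :: "('a::complex_inner \<Rightarrow> 'a) \<Rightarrow> 'a op" where
  "op_of_fun f = {(x, f x) | x. True}"

definition point_spectrum :: "'a::complex_inner op \<Rightarrow> complex set" where
  "point_spectrum T = {w. \<exists>f. f \<noteq> 0 \<and> f \<in> op_ker (op_shift T w)}"

definition resolvent :: "'a::complex_inner op \<Rightarrow> complex \<Rightarrow> 'a \<Rightarrow> 'a" where
  "resolvent T w = (\<lambda>h. THE f. (f, h) \<in> op_shift T w)"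

definition resolvent_set :: "'a::complex_inner op \<Rightarrow> complex set" where
  "resolvent_set T = {w. (\<forall>h. \<exists>!f. (f, h) \<in> op_shift T w) \<and> bounded_clinear (resolvent T w)}"

text \<open>
  The boundary maps \<open>\<Gamma>0\<close>, \<open>\<Gamma>1\<close> are only meaningful on \<^term>\<open>Domain A\<close>; their values
  elsewhere are never used.
\<close>

definition op_A0 :: "'h::complex_inner op \<Rightarrow> ('h \<Rightarrow> 'g::complex_inner) \<Rightarrow> 'h op" where
  "op_A0 A \<Gamma>0 = op_restrict A {f \<in> Domain A. \<Gamma>0 f = 0}"

definition op_AB ::
  "'h::complex_inner op \<Rightarrow> ('h \<Rightarrow> 'g::complex_inner) \<Rightarrow> ('h \<Rightarrow> 'g) \<Rightarrow> ('g \<Rightarrow> 'g) \<Rightarrow> 'h op" where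
  "op_AB A \<Gamma>0 \<Gamma>1 B = op_restrict A {f \<in> Domain A. \<Gamma>0 f + B (\<Gamma>1 f) = 0}"

definition generalized_boundary_triple ::
  "'h::chilbert_space op \<Rightarrow> 'h op \<Rightarrow> ('h \<Rightarrow> 'g::chilbert_space) \<Rightarrow> ('h \<Rightarrow> 'g) \<Rightarrow> bool" where
  "generalized_boundary_triple S A \<Gamma>0 \<Gamma>1 \<longleftrightarrow>
     symmetric_operator S \<and> closed S \<and> is_operator A \<and> closure A = op_adjoint S
     \<and> clinear_on (Domain A) \<Gamma>0 \<and> clinear_on (Domain A) \<Gamma>1
     \<and> self_adjoint (op_A0 A \<Gamma>0)
     \<and> \<Gamma>0 ` Domain A = UNIV
     \<and> (\<forall>(f, Af)\<in>A. \<forall>(g, Ag)\<in>A.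
          cinner Af g - cinner f Ag = cinner (\<Gamma>1 f) (\<Gamma>0 g) - cinner (\<Gamma>0 f) (\<Gamma>1 g))"

definition gamma_field ::
  "'h::complex_inner op \<Rightarrow> ('h \<Rightarrow> 'g::complex_inner) \<Rightarrow> complex \<Rightarrow> 'g \<Rightarrow> 'h" where
  "gamma_field A \<Gamma>0 w = inv_into (op_ker (op_shift A w)) \<Gamma>0"

definition weyl_function ::
  "'h::complex_inner op \<Rightarrow> ('h \<Rightarrow> 'g::complex_inner) \<Rightarrow> ('h \<Rightarrow> 'g) \<Rightarrow> complex \<Rightarrow> 'g \<Rightarrow> 'g" where
  "weyl_function A \<Gamma>0 \<Gamma>1 w = \<Gamma>1 \<circ> gamma_field A \<Gamma>0 w"

text \<open>The operator \<open>I + B2 M(w) B1\<close>, with \<open>M\<close> the Weyl function.\<close>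

definition weyl_perturbation ::
  "'h::complex_inner op \<Rightarrow> ('h \<Rightarrow> 'g::complex_inner) \<Rightarrow> ('h \<Rightarrow> 'g) \<Rightarrow>
     ('k::complex_inner \<Rightarrow> 'g) \<Rightarrow> ('g \<Rightarrow> 'k) \<Rightarrow> complex \<Rightarrow> 'k \<Rightarrow> 'k" where
  "weyl_perturbation A \<Gamma>0 \<Gamma>1 B1 B2 w = (\<lambda>x. x + B2 (weyl_function A \<Gamma>0 \<Gamma>1 w (B1 x)))"

end

theory Submission
  imports Defs
begin

text \<open>
  Green's identity exhibits the adjoints \<open>\<gamma>(cnj w)* = \<Gamma>1 (A0 - w)^(-1)\<close> and \<open>M(w)* = M(cnj w)\<close> as
  everywhere defined maps, so \<open>\<gamma>(w)\<close> and \<open>M(w)\<close> are bounded by Hellinger--Toeplitz; it also shows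
  that \<open>A_B\<close> is symmetric. A vector \<open>\<gamma>(w) \<phi>\<close> lies in \<open>Ker (A_B - w)\<close> iff \<open>\<phi> + B M(w) \<phi> = 0\<close>. As
  \<open>B M(w)\<close> is compact, off the point spectrum \<open>I + B1 B2 M(w)\<close> is invertible, and then so is
  \<open>I + B2 M(w) B1\<close>, whose inverse gives an explicit solution of \<open>(A_B - w) f = h\<close>: this is the
  resolvent formula. The numbers \<open>i\<close> and \<open>-i\<close> are not eigenvalues of the symmetric operator \<open>A_B\<close>, so
  \<open>A_B - i\<close> and \<open>A_B + i\<close> are onto and \<open>A_B\<close> is self-adjoint.
\<close>

section \<open>Real Hilbert spaces\<close>

text \<open>A minimising sequence for the distance to \<open>V\<close> is Cauchy by the
  parallelogram law. Its limit is a nearest point, and varying that point along \<open>v\<close>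
  gives orthogonality.\<close>

lemma ex_orthogonal_projection:
  fixes V :: "'a::{real_inner,complete_space} set"
  assumes "subspace V" "closed V"
  shows "\<exists>y\<in>V. \<forall>v\<in>V. inner (x - y) v = 0"
proof -
  define d where "d = infdist x V"
  have ne: "V \<noteq> {}" using assms(1) subspace_0 by blast
  have d0: "0 \<le> d" by (simp add: d_def infdist_nonneg)
  have dle: "d\<^sup>2 \<le> (norm (x - v))\<^sup>2" if "v \<in> V" for v
    using infdist_le[OF that, of x] d0 by (simp add: d_def dist_norm power_mono)
  have "\<exists>v\<in>V. (norm (x - v))\<^sup>2 < d\<^sup>2 + e" if "e > 0" for e
  proof -
    have "d < sqrt (d\<^sup>2 + e)" using that d0 by (simp add: real_less_rsqrt)
    then have "Inf (dist x ` V) < sqrt (d\<^sup>2 + e)" using ne by (simp add: d_def infdist_notempty)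
    then obtain v where "v \<in> V" "dist x v < sqrt (d\<^sup>2 + e)"
      using cInf_lessD[of "dist x ` V"] ne by blast
    moreover have "(norm (x - v))\<^sup>2 < (sqrt (d\<^sup>2 + e))\<^sup>2"
      using calculation(2) by (intro power_strict_mono) (auto simp: dist_norm)
    ultimately show ?thesis using that by (auto intro!: bexI[of _ v] simp: add_nonneg_nonneg)
  qed
  then have "\<exists>v\<in>V. (norm (x - v))\<^sup>2 < d\<^sup>2 + inverse (real (Suc n))" for n
    by simp
  then obtain y where yV: "\<And>n. y n \<in> V"
    and y: "\<And>n. (norm (x - y n))\<^sup>2 < d\<^sup>2 + inverse (real (Suc n))"
    by metis
  have est: "(norm (y m - y n))\<^sup>2 \<le> 2 * inverse (real (Suc m)) + 2 * inverse (real (Suc n))" for m n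
  proof -
    \<comment> \<open>The midpoint is no closer to \<open>x\<close> than \<open>d\<close>. This
      bounds the sum term of the parallelogram identity from below, hence the difference term from
      above.\<close>
    have "(1/2) *\<^sub>R (y m + y n) \<in> V"
      using yV assms(1) by (simp add: subspace_add subspace_scale)
    from dle[OF this]
    have "4 * d\<^sup>2 \<le> 4 * (norm (x - (1/2) *\<^sub>R (y m + y n)))\<^sup>2" by simp
    also have "\<dots> = (norm ((x - y m) + (x - y n)))\<^sup>2"
      by (simp add: power2_norm_eq_inner inner_simps inner_commute)
    finally have "4 * d\<^sup>2 \<le> (norm ((x - y m) + (x - y n)))\<^sup>2" .
    moreover have "(norm (y m - y n))\<^sup>2 + (norm ((x - y m) + (x - y n)))\<^sup>2
        = 2 * (norm (x - y m))\<^sup>2 + 2 * (norm (x - y n))\<^sup>2"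
      by (simp add: power2_norm_eq_inner inner_simps inner_commute)
    ultimately show ?thesis using y[of m] y[of n] by linarith
  qed
  have "Cauchy y"
  proof (rule metric_CauchyI)
    fix e :: real assume "e > 0"
    then obtain N where N: "inverse (real (Suc N)) < e\<^sup>2 / 4"
      using reals_Archimedean[of "e\<^sup>2 / 4"] by auto
    have "dist (y m) (y n) < e" if "m \<ge> N" "n \<ge> N" for m n
    proof -
      have "inverse (real (Suc m)) \<le> inverse (real (Suc N))" "inverse (real (Suc n)) \<le> inverse (real (Suc N))"
        using that by (auto intro!: le_imp_inverse_le)
      then have "(norm (y m - y n))\<^sup>2 < e\<^sup>2" using est[of m n] N by linarith
      then show ?thesis using \<open>e > 0\<close> by (simp add: dist_norm power2_less_imp_less)
    qed
    then show "\<exists>M. \<forall>m\<ge>M. \<forall>n\<ge>M. dist (y m) (y n) < e" by blast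
  qed
  then obtain z where z: "y \<longlonglongrightarrow> z" using Cauchy_convergent convergent_def by blast
  have zV: "z \<in> V" using assms(2) yV z closed_sequentially by blast
  have "(\<lambda>n. (norm (x - y n))\<^sup>2) \<longlonglongrightarrow> (norm (x - z))\<^sup>2" by (intro tendsto_intros z)
  moreover have "(\<lambda>n. d\<^sup>2 + inverse (real (Suc n))) \<longlonglongrightarrow> d\<^sup>2 + 0"
    by (intro tendsto_intros LIMSEQ_inverse_real_of_nat)
  ultimately have zd: "(norm (x - z))\<^sup>2 \<le> d\<^sup>2"
    using y by (force intro: LIMSEQ_le less_imp_le)
  have "inner (x - z) v = 0" if v: "v \<in> V" for v
  proof (cases "v = 0")
    case False
    \<comment> \<open>This \<open>t\<close> minimises \<open>norm ((x - z) - t *\<^sub>R v)\<close>.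
      Since \<open>z\<close> is already nearest, the resulting decrease must be zero.\<close>
    define t where "t = inner (x - z) v / (norm v)\<^sup>2"
    have "z + t *\<^sub>R v \<in> V" using zV v assms(1) by (simp add: subspace_add subspace_scale)
    from order_trans[OF zd dle[OF this]]
    have "(norm (x - z))\<^sup>2 \<le> (norm ((x - z) - t *\<^sub>R v))\<^sup>2" by (simp add: algebra_simps)
    also have "\<dots> = (norm (x - z))\<^sup>2 - 2 * t * inner (x - z) v + t\<^sup>2 * (norm v)\<^sup>2"
      unfolding power2_norm_eq_inner
      by (simp add: inner_diff_left inner_diff_right inner_commute power2_eq_square algebra_simps)
    also have "\<dots> = (norm (x - z))\<^sup>2 - (inner (x - z) v)\<^sup>2 / (norm v)\<^sup>2"
      using False by (simp add: t_def field_simps power2_eq_square)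
    finally have "(inner (x - z) v)\<^sup>2 / (norm v)\<^sup>2 \<le> 0" by simp
    then show ?thesis using False by (simp add: divide_le_0_iff)
  qed simp
  then show ?thesis using zV by blast
qed

text \<open>The residual of the projection onto \<open>V\<close> is orthogonal to \<open>V\<close>,
  hence zero. This is the criterion behind every density and surjectivity argument below.\<close>

lemma closed_subspace_eq_UNIV:
  fixes V :: "'a::{real_inner,complete_space} set"
  assumes "subspace V" "closed V" and "\<And>z. (\<And>v. v \<in> V \<Longrightarrow> inner z v = 0) \<Longrightarrow> z = 0"
  shows "V = UNIV"
proof -
  have "x \<in> V" for x
    using ex_orthogonal_projection[OF assms(1,2), of x] assms(3)
    by (metis eq_iff_diff_eq_0)
  then show ?thesis by blast
qed

lemma subspace_closure:
  fixes V :: "'a::real_normed_vector set"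
  assumes "subspace V"
  shows "subspace (closure V)"
proof (rule subspaceI)
  show "0 \<in> closure V" using assms closure_subset subspace_0 by blast
  fix x c assume "x \<in> closure V"
  then obtain a where a: "\<And>n. a n \<in> V" "a \<longlonglongrightarrow> x" unfolding closure_sequential by blast
  have "\<And>n. c *\<^sub>R a n \<in> V" using a assms by (simp add: subspace_scale)
  moreover have "(\<lambda>n. c *\<^sub>R a n) \<longlonglongrightarrow> c *\<^sub>R x" using a by (intro tendsto_intros)
  ultimately show "c *\<^sub>R x \<in> closure V"
    unfolding closure_sequential by (intro exI[of _ "\<lambda>n. c *\<^sub>R a n"]) simp
  fix y assume "y \<in> closure V"
  then obtain b where b: "\<And>n. b n \<in> V" "b \<longlonglongrightarrow> y" unfolding closure_sequential by blast
  have "\<And>n. a n + b n \<in> V" using a b assms by (simp add: subspace_add)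
  moreover have "(\<lambda>n. a n + b n) \<longlonglongrightarrow> x + y" using a b by (intro tendsto_intros)
  ultimately show "x + y \<in> closure V"
    unfolding closure_sequential by (intro exI[of _ "\<lambda>n. a n + b n"]) simp
qed

text \<open>The kernel of a nonzero \<open>f\<close> is a proper closed subspace. A nonzero vector
  orthogonal to it, suitably rescaled, represents \<open>f\<close>.\<close>

lemma riesz_representation:
  fixes f :: "'a::{real_inner,complete_space} \<Rightarrow> real"
  assumes "bounded_linear f"
  shows "\<exists>y. \<forall>x. f x = inner y x"
proof (cases "\<forall>x. f x = 0")
  case False
  interpret bounded_linear f by fact
  define V where "V = {x. f x = 0}"
  have "subspace V" by (auto simp: V_def subspace_def add scaleR zero)
  moreover have "closed V" unfolding V_def
    by (intro closed_Collect_eq continuous_intros linear_continuous_on assms)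
  moreover have "V \<noteq> UNIV" using False by (auto simp: V_def)
  ultimately obtain z where z: "z \<noteq> 0" "\<And>v. v \<in> V \<Longrightarrow> inner z v = 0"
    using closed_subspace_eq_UNIV by metis
  have "f z \<noteq> 0" using z by (metis V_def inner_eq_zero_iff mem_Collect_eq)
  have "f x = inner ((f z / inner z z) *\<^sub>R z) x" for x
  proof -
    \<comment> \<open>Splitting off the right multiple of \<open>z\<close> leaves a vector in the
      kernel, which \<open>z\<close> does not see.\<close>
    have "x - (f x / f z) *\<^sub>R z \<in> V" using \<open>f z \<noteq> 0\<close> by (simp add: V_def diff scaleR)
    then have "inner z x = f x / f z * inner z z" using z(2) by (force simp: inner_diff_right)
    then show ?thesis using \<open>f z \<noteq> 0\<close> z(1) by simp
  qed
  then show ?thesis by blast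
qed (auto intro: exI[of _ 0])

text \<open>Hellinger--Toeplitz. The sets where \<open>norm (f x) \<le> n\<close> are closed because
  \<open>norm (f x) \<le> n\<close> can be tested on the functionals \<open>inner (f x) y = inner x (g y)\<close>.\<close>

lemma bounded_linear_if_adjoint:
  fixes f :: "'a::{real_inner,complete_space} \<Rightarrow> 'b::real_inner"
  assumes adj: "\<And>x y. inner (f x) y = inner x (g y)"
  shows "bounded_linear f"
proof -
  have lin: "linear f"
  proof
    show "f (x + y) = f x + f y" for x y
      by (subst vector_eq_rdot[symmetric]) (simp add: adj inner_add_left)
    show "f (r *\<^sub>R x) = r *\<^sub>R f x" for r x
      by (subst vector_eq_rdot[symmetric]) (simp add: adj)
  qed
  define E where "E n = {x. norm (f x) \<le> real n}" for n :: nat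
  have E_eq: "E n = (\<Inter>y. {x. inner x (g y) \<le> real n * norm y})" for n
  proof (intro set_eqI iffI)
    fix x assume "x \<in> E n"
    then have "inner (f x) y \<le> real n * norm y" for y
      using norm_cauchy_schwarz[of "f x" y] mult_right_mono[of "norm (f x)" "real n" "norm y"]
      by (simp add: E_def)
    then show "x \<in> (\<Inter>y. {x. inner x (g y) \<le> real n * norm y})" by (simp add: adj)
  next
    fix x assume "x \<in> (\<Inter>y. {x. inner x (g y) \<le> real n * norm y})"
    \<comment> \<open>The condition is tested at \<open>y = f x\<close>.\<close>
    then have "inner (f x) (f x) \<le> real n * norm (f x)" by (simp add: adj)
    then have "norm (f x) * norm (f x) \<le> real n * norm (f x)"
      by (simp add: norm_eq_sqrt_inner)
    then show "x \<in> E n" by (cases "f x = 0") (auto simp: E_def)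
  qed
  have closedE: "closed (E n)" for n
    unfolding E_eq by (intro closed_INT ballI closed_Collect_le continuous_intros)
  have "(\<Union>n. E n) = UNIV"
    using real_arch_simple by (force simp: E_def)
  \<comment> \<open>Baire: if all the closed sets \<open>E n\<close> had empty interior, so would
    their union, which is the whole space.\<close>
  moreover have "Met_TC.mtopology interior_of \<Union> (range E) = {}" if "\<And>n. interior (E n) = {}"
    using closedE that
    by (intro Met_TC.metric_Baire_category_alt) (auto simp: complete_UNIV)
  ultimately obtain n where "interior (E n) \<noteq> {}" by fastforce
  then obtain a e where e: "e > 0" "ball a e \<subseteq> E n"
    by (meson equals0I mem_interior)
  have "norm (f x) \<le> norm x * (4 * real n / e)" for x
  proof (cases "x = 0")
    case True
    then show ?thesis using lin by (simp add: linear_0)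
  next
    case False
    \<comment> \<open>The rescaled vector has norm \<open>e / 2\<close>, so
      \<open>a + s *\<^sub>R x\<close> stays in the ball. Both \<open>f\<close> values there have
      norm at most \<open>n\<close>, which leads to the constant \<open>4 * n / e\<close>.\<close>
    define s where "s = e / (2 * norm x)"
    have s: "s > 0" "norm (s *\<^sub>R x) < e" using False e(1) by (simp_all add: s_def)
    then have "a + s *\<^sub>R x \<in> E n" "a \<in> E n" using e by (auto simp: dist_norm)
    then have "norm (f (a + s *\<^sub>R x) - f a) \<le> 2 * real n"
      using norm_triangle_ineq4[of "f (a + s *\<^sub>R x)" "f a"] by (simp add: E_def)
    then have "s * norm (f x) \<le> 2 * real n"
      using s(1) lin by (simp add: linear_add linear_scale)
    then show ?thesis using False e(1) by (simp add: s_def field_simps)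
  qed
  then show ?thesis using lin by (auto simp: bounded_linear_def bounded_linear_axioms_def intro!: exI[of _ "4 * real n / e"])
qed

section \<open>Complex inner products and adjoints\<close>

lemma scaleC_zero_right [simp]: "c *\<^sub>C (0::'a::complex_inner) = 0"
  using scaleC_add_right[of c 0 "0::'a"] by simp

lemma scaleC_zero_left [simp]: "0 *\<^sub>C (x::'a::complex_inner) = 0"
  using scaleC_of_real[of 0 x] by simp

lemma scaleC_one [simp]: "1 *\<^sub>C (x::'a::complex_inner) = x"
  using scaleC_of_real[of 1 x] by simp

lemma scaleC_minus_one: "(- 1) *\<^sub>C (x::'a::complex_inner) = - x"
  using scaleC_of_real[of "-1" x] by simp

lemma scaleC_minus_right: "c *\<^sub>C (- x) = - (c *\<^sub>C (x::'a::complex_inner))"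
  using scaleC_add_right[of c x "- x"] by (simp add: eq_neg_iff_add_eq_0 add.commute)

lemma scaleC_diff_right: "c *\<^sub>C (x - y) = c *\<^sub>C x - c *\<^sub>C (y::'a::complex_inner)"
  using scaleC_add_right[of c x "- y"] by (simp add: scaleC_minus_right)

lemma cinner_add_left: "cinner (x + y) z = cinner x z + cinner y (z::'a::complex_inner)"
  by (metis cinner_add_right cinner_commute complex_cnj_add)

lemma cinner_scaleC_left: "cinner (c *\<^sub>C x) y = cnj c * cinner x (y::'a::complex_inner)"
  by (metis cinner_scaleC_right cinner_commute complex_cnj_mult)

lemma cinner_zero_right [simp]: "cinner x (0::'a::complex_inner) = 0"
  using cinner_scaleC_right[of x 0 0] by simp

lemma cinner_zero_left [simp]: "cinner 0 (x::'a::complex_inner) = 0"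
  using cinner_scaleC_left[of 0 0 x] by simp

lemma cinner_minus_right: "cinner x (- y) = - cinner x (y::'a::complex_inner)"
  by (metis cinner_scaleC_right mult_minus1 scaleC_minus_one)

lemma cinner_minus_left: "cinner (- x) y = - cinner x (y::'a::complex_inner)"
  by (metis cinner_commute cinner_minus_right complex_cnj_minus)

lemma cinner_diff_right: "cinner x (y - z) = cinner x y - cinner x (z::'a::complex_inner)"
  by (metis add_uminus_conv_diff cinner_add_right cinner_minus_right)

lemma cinner_diff_left: "cinner (x - y) z = cinner x z - cinner y (z::'a::complex_inner)"
  by (metis add_uminus_conv_diff cinner_add_left cinner_minus_left)

lemmas cinner_simps = cinner_add_left cinner_add_right cinner_diff_left cinner_diff_right
  cinner_minus_left cinner_minus_right cinner_scaleC_left cinner_scaleC_right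

lemma cinner_self_eq_0: "cinner x x = 0 \<longleftrightarrow> x = (0::'a::complex_inner)"
  by (metis Re_cinner cinner_zero_right inner_eq_zero_iff zero_complex.sel(1))

lemma cinner_ext: "(\<And>x. cinner x y = cinner x z) \<Longrightarrow> y = (z::'a::complex_inner)"
  by (metis cinner_diff_right cinner_self_eq_0 eq_iff_diff_eq_0)

lemma Im_cinner_self: "Im (cinner x (x::'a::complex_inner)) = 0"
  using arg_cong[OF cinner_commute[of x x], of Im] by simp

lemma norm_scaleC: "norm (c *\<^sub>C (x::'a::complex_inner)) = cmod c * norm x"
proof -
  have "inner (c *\<^sub>C x) (c *\<^sub>C x) = Re (c * cnj c * cinner x x)"
    by (simp add: Re_cinner[symmetric] cinner_scaleC_left cinner_scaleC_right mult.assoc)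
  also have "\<dots> = (cmod c)\<^sup>2 * inner x x"
    by (simp add: complex_norm_square[symmetric] Re_cinner)
  finally show ?thesis by (simp add: norm_eq_sqrt_inner real_sqrt_mult)
qed

lemma bounded_linear_scaleC: "bounded_linear (\<lambda>x::'a::complex_inner. c *\<^sub>C x)"
  by (rule bounded_linear_intro[where K = "cmod c"])
    (simp_all add: scaleC_add_right norm_scaleC scaleC_of_real[symmetric] scaleC_scaleC mult.commute)

text \<open>Multiplying by \<open>- \<i>\<close> moves the imaginary part into the real part, so
  facts on the real inner product carry over.\<close>

lemma cinner_eq_inner: "cinner x (y::'a::complex_inner) = Complex (inner x y) (inner x ((- \<i>) *\<^sub>C y))"
  by (simp add: complex_eq_iff Re_cinner[symmetric] cinner_scaleC_right)

lemma continuous_scaleC [continuous_intros]: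
  "continuous_on S f \<Longrightarrow> continuous_on S (\<lambda>x. c *\<^sub>C (f x :: 'a::complex_inner))"
  by (rule bounded_linear.continuous_on[OF bounded_linear_scaleC])

lemma continuous_cinner [continuous_intros]:
  "continuous_on S f \<Longrightarrow> continuous_on S (\<lambda>x. cinner y (f x :: 'a::complex_inner))"
  unfolding cinner_eq_inner Complex_eq by (intro continuous_intros)

lemma cmod_cinner_le: "cmod (cinner x y) \<le> norm x * norm (y::'a::complex_inner)"
proof (cases "cinner x y = 0")
  case False
  \<comment> \<open>A phase that makes \<open>cinner x (c *\<^sub>C y)\<close> real and nonnegative,
    so that the real Cauchy-Schwarz inequality applies.\<close>
  define c where "c = cnj (cinner x y) / cmod (cinner x y)"
  have "c * cinner x y = cmod (cinner x y)"
    using False by (simp add: c_def complex_norm_square[symmetric] mult.commute power2_eq_square)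
  then have "cmod (cinner x y) = inner x (c *\<^sub>C y)"
    by (metis Re_complex_of_real Re_cinner cinner_scaleC_right)
  also have "\<dots> \<le> norm x * norm (c *\<^sub>C y)" by (rule norm_cauchy_schwarz)
  also have "norm (c *\<^sub>C y) = norm y"
    using False by (simp add: norm_scaleC c_def norm_divide)
  finally show ?thesis .
qed simp

text \<open>Real parts reduce boundedness to the real Hellinger-Toeplitz lemma. Complex homogeneity
  follows by pairing with all vectors.\<close>

lemma bounded_clinear_if_adjoint:
  fixes f :: "'a::chilbert_space \<Rightarrow> 'b::complex_inner"
  assumes adj: "\<And>x y. cinner (f x) y = cinner x (g y)"
  shows "bounded_clinear f"
proof -
  have "bounded_linear f"
    by (rule bounded_linear_if_adjoint[of f g]) (simp add: adj Re_cinner[symmetric])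
  moreover have adj': "cinner y (f x) = cinner (g y) x" for x y
    using arg_cong[OF adj[of x y], of cnj] by (simp add: cinner_commute[symmetric])
  have "f (c *\<^sub>C x) = c *\<^sub>C f x" for c x
    by (rule cinner_ext) (simp add: adj' cinner_scaleC_right)
  ultimately show ?thesis by (simp add: bounded_clinear_def)
qed

lemma cadjoint_eqI:
  assumes "\<And>x y. cinner (f x) y = cinner x (g y)"
  shows "cadjoint f = g"
  unfolding cadjoint_def
proof (rule the_equality)
  fix g' assume "\<forall>x y. cinner (f x) y = cinner x (g' y)"
  then show "g' = g" using assms by (metis cinner_ext ext)
qed (use assms in blast)

text \<open>Riesz gives an adjoint for the real inner product, and complex homogeneity of
  \<open>f\<close> makes it the complex one. Thus the \<open>THE\<close> in \<open>cadjoint\<close>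
  denotes.\<close>

lemma cinner_cadjoint:
  fixes f :: "'a::chilbert_space \<Rightarrow> 'b::complex_inner"
  assumes "bounded_clinear f"
  shows "cinner (f x) y = cinner x (cadjoint f y)"
proof -
  have bl: "bounded_linear f" and hom: "\<And>c x. f (c *\<^sub>C x) = c *\<^sub>C f x"
    using assms by (auto simp: bounded_clinear_def)
  have "\<exists>z. \<forall>x. inner y (f x) = inner z x" for y
    using bl by (intro riesz_representation bounded_linear_inner_right_comp)
  then obtain g where "\<And>x y. inner y (f x) = inner (g y) x" by metis
  then have g: "inner (f x) y = inner x (g y)" for x y by (simp add: inner_commute)
  have "Im (cinner (f x) y) = Im (cinner x (g y))" for x y
    \<comment> \<open>Replacing \<open>x\<close> by \<open>\<i> *\<^sub>C x\<close> turns the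
      identity of real parts into one of imaginary parts.\<close>
    using g[of "\<i> *\<^sub>C x" y]
    by (simp add: hom Re_cinner[symmetric] cinner_scaleC_left)
  then have "cinner (f x) y = cinner x (g y)" for x y
    using g by (simp add: complex_eq_iff Re_cinner)
  then show ?thesis using cadjoint_eqI[of f g] by simp
qed

text \<open>Upgrades real to complex orthogonality for sets closed under complex scalars:
  \<open>c = 1\<close> and \<open>c = - \<i>\<close> give the real and imaginary parts.\<close>

lemma cinner_eq_0_if_inner:
  assumes "\<And>c. inner z (c *\<^sub>C v) = 0"
  shows "cinner z (v::'a::complex_inner) = 0"
  using assms[of 1] assms[of "- \<i>"] by (simp add: cinner_eq_inner complex_eq_iff)

lemma cinner_orthogonal_UNIV: "(\<And>h. cinner z h = 0) \<Longrightarrow> z = (0::'a::complex_inner)"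
  using cinner_self_eq_0 by blast

section \<open>Symmetric and self-adjoint operators\<close>

text \<open>The lower bound makes \<open>snd\<close> bounded below on the complete graph
  \<open>T\<close>, so the range is closed; its orthogonal complement is trivial by
  assumption.\<close>

lemma Range_eq_UNIV_if_bounded_below:
  fixes T :: "('a::{real_inner,complete_space} \<times> 'b::{real_inner,complete_space}) set"
  assumes "subspace T" "closed T" "c > 0"
    and below: "\<And>f h. (f, h) \<in> T \<Longrightarrow> c * norm f \<le> norm h"
    and "\<And>z. (\<And>f h. (f, h) \<in> T \<Longrightarrow> inner z h = 0) \<Longrightarrow> z = 0"
  shows "Range T = UNIV"
proof -
  \<comment> \<open>The constant comes from \<open>norm p \<le> norm f + norm h\<close> together
    with \<open>c * norm f \<le> norm h\<close>.\<close>
  have "c / (1 + c) * norm p \<le> norm (snd p)" if "p \<in> T" for p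
  proof -
    obtain f h where p: "p = (f, h)" by (cases p)
    have "c * norm p \<le> c * norm f + c * norm h"
      unfolding p using norm_Pair_le[of f h] \<open>c > 0\<close>
      by (simp add: distrib_left[symmetric])
    also have "\<dots> \<le> (1 + c) * norm h" using below[of f h] that p by (simp add: algebra_simps)
    finally show ?thesis using \<open>c > 0\<close> p by (simp add: field_simps)
  qed
  then have "complete (snd ` T)"
    using assms(1-3) by (intro complete_isometric_image[where e = "c / (1 + c)"])
      (auto simp: bounded_linear_snd complete_eq_closed)
  then have "closed (Range T)" by (simp add: complete_eq_closed Range_snd)
  moreover have "subspace (Range T)"
    unfolding Range_snd using assms(1)
    by (intro linear_subspace_image) (simp_all add: bounded_linear.linear bounded_linear_snd)
  ultimately show ?thesis
    using assms(5) by (intro closed_subspace_eq_UNIV) (auto simp: Range_iff)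
qed

lemma mem_op_shift [simp]: "(f, h) \<in> op_shift T w \<longleftrightarrow> (f, h + w *\<^sub>C f) \<in> T"
  by (force simp: op_shift_def)

lemma
  assumes "is_operator T"
  shows op_zero: "(0, 0) \<in> T"
    and op_add: "(f, f') \<in> T \<Longrightarrow> (g, g') \<in> T \<Longrightarrow> (f + g, f' + g') \<in> T"
    and op_scale: "(f, f') \<in> T \<Longrightarrow> (c *\<^sub>C f, c *\<^sub>C f') \<in> T"
    and op_unique: "(f, f') \<in> T \<Longrightarrow> (f, f'') \<in> T \<Longrightarrow> f' = f''"
  using assms by (auto simp: is_operator_def single_valued_def)

lemma op_diff:
  assumes "is_operator T" "(f, f') \<in> T" "(g, g') \<in> T"
  shows "(f - g, f' - g') \<in> T"
  using op_add[OF assms(1,2) op_scale[OF assms(1,3), of "-1"]] by (simp add: scaleC_minus_one)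

lemma is_operator_op_shift:
  assumes "is_operator T"
  shows "is_operator (op_shift T w)"
  unfolding is_operator_def mem_op_shift
proof (intro conjI allI impI)
  show "single_valued (op_shift T w)"
    unfolding single_valued_def using op_unique[OF assms] by fastforce
  show "(0, 0 + w *\<^sub>C 0) \<in> T" using op_zero[OF assms] by simp
  fix f f' g g' c
  assume f: "(f, f' + w *\<^sub>C f) \<in> T"
  show "(c *\<^sub>C f, c *\<^sub>C f' + w *\<^sub>C c *\<^sub>C f) \<in> T"
    using op_scale[OF assms f, of c] by (simp add: scaleC_add_right scaleC_scaleC mult.commute)
  assume "(g, g' + w *\<^sub>C g) \<in> T"
  from op_add[OF assms f this]
  show "(f + g, f' + g' + w *\<^sub>C (f + g)) \<in> T" by (simp add: scaleC_add_right algebra_simps)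
qed

lemma subspace_op: "is_operator T \<Longrightarrow> subspace T"
  by (auto simp: subspace_def op_zero op_add op_scale zero_prod_def scaleC_of_real[symmetric])

lemma closed_op_shift:
  assumes "closed T"
  shows "closed (op_shift T w)"
proof -
  have "op_shift T w = (\<lambda>p. (fst p, snd p + w *\<^sub>C fst p)) -` T" by auto
  then show ?thesis
    by (simp only:) (intro closed_vimage assms continuous_intros)
qed

lemma mem_op_adjoint: "(g, h) \<in> op_adjoint T \<longleftrightarrow> (\<forall>f f'. (f, f') \<in> T \<longrightarrow> cinner f' g = cinner f h)"
  by (auto simp: op_adjoint_def)

lemma closed_op_adjoint: "closed (op_adjoint T)"
proof -
  have "op_adjoint T = (\<Inter>p\<in>T. {q. cinner (snd p) (fst q) = cinner (fst p) (snd q)})"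
    by (force simp: op_adjoint_def)
  then show ?thesis
    by (simp only:) (intro closed_INT ballI closed_Collect_eq continuous_intros)
qed

section \<open>Resolvents of symmetric and self-adjoint operators\<close>

lemma op_shift_resolvent:
  assumes "w \<in> resolvent_set T"
  shows "(resolvent T w h, h) \<in> op_shift T w"
  using assms theI'[of "\<lambda>f. (f, h) \<in> op_shift T w"] by (auto simp: resolvent_set_def resolvent_def)

lemma resolvent_eqI:
  assumes "w \<in> resolvent_set T" "(f, h) \<in> op_shift T w"
  shows "resolvent T w h = f"
  using assms op_shift_resolvent[OF assms(1), of h] unfolding resolvent_set_def by blast

lemma not_in_point_spectrum_if_resolvent_set:
  assumes "is_operator T" "w \<in> resolvent_set T"
  shows "w \<notin> point_spectrum T"
proof
  assume "w \<in> point_spectrum T"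
  then obtain f where "f \<noteq> 0" "(f, 0) \<in> op_shift T w"
    by (auto simp: point_spectrum_def op_ker_def)
  moreover have "(0, 0) \<in> op_shift T w" by (rule op_zero[OF is_operator_op_shift[OF assms(1)]])
  ultimately show False using resolvent_eqI[OF assms(2)] by metis
qed

text \<open>The terms with \<open>w\<close> and \<open>cnj w\<close> cancel because
  \<open>cinner\<close> is antilinear on the left. So \<open>T - w\<close> and
  \<open>T - cnj w\<close> are formally adjoint.\<close>

lemma cinner_op_shift_symmetric:
  assumes "T \<subseteq> op_adjoint T" "(f, h) \<in> op_shift T w" "(g, k) \<in> op_shift T (cnj w)"
  shows "cinner h g = cinner f k"
proof -
  have "cinner (h + w *\<^sub>C f) g = cinner f (k + cnj w *\<^sub>C g)"
    using assms by (metis mem_op_adjoint mem_op_shift subsetD)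
  then show ?thesis by (simp add: cinner_simps)
qed

text \<open>For symmetric \<open>T\<close> the form \<open>cinner f (T f)\<close> is real, so the
  imaginary part of \<open>cinner f h\<close> is \<open>- Im w * (norm f)\<^sup>2\<close>;
  Cauchy-Schwarz finishes.\<close>

lemma norm_op_shift_symmetric:
  assumes "T \<subseteq> op_adjoint T" "(f, h) \<in> op_shift T w"
  shows "\<bar>Im w\<bar> * norm f \<le> norm h"
proof -
  have "cinner (h + w *\<^sub>C f) f = cinner f (h + w *\<^sub>C f)"
    using assms by (metis mem_op_adjoint mem_op_shift subsetD)
  then have "Im (cinner f (h + w *\<^sub>C f)) = 0"
    using arg_cong[OF cinner_commute[of f "h + w *\<^sub>C f"], of Im] by simp
  then have "\<bar>Im w\<bar> * (norm f)\<^sup>2 = \<bar>Im (cinner f h)\<bar>"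
    using abs_mult[of "Im w" "inner f f"]
    by (simp add: cinner_simps Im_cinner_self Re_cinner power2_norm_eq_inner add_eq_0_iff)
  also have "\<dots> \<le> norm f * norm h"
    using abs_Im_le_cmod cmod_cinner_le order_trans by blast
  finally show ?thesis by (cases "f = 0") (auto simp: power2_eq_square)
qed

text \<open>Surjectivity at \<open>cnj w\<close> forces injectivity at \<open>w\<close>, and
  conversely. The two resolvents are then everywhere defined adjoints of each other, hence bounded
  by Hellinger-Toeplitz.\<close>

lemma in_resolvent_set_if_symmetric:
  fixes T :: "'a::chilbert_space op"
  assumes op: "is_operator T" and sym: "T \<subseteq> op_adjoint T"
    and rg: "Range (op_shift T w) = UNIV" "Range (op_shift T (cnj w)) = UNIV"
  shows "w \<in> resolvent_set T"
proof -
  have ex1: "\<exists>!f. (f, h) \<in> op_shift T v" if v: "Range (op_shift T v) = UNIV" "Range (op_shift T (cnj v)) = UNIV" for v h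
  proof (rule ex_ex1I)
    show "\<exists>f. (f, h) \<in> op_shift T v" using v(1) by blast
    fix f g assume "(f, h) \<in> op_shift T v" "(g, h) \<in> op_shift T v"
    then have *: "(f - g, 0) \<in> op_shift T v"
      using op_diff[OF is_operator_op_shift[OF op]] by (metis diff_self)
    have "cinner (f - g) k = 0" for k
      using v(2) cinner_op_shift_symmetric[OF sym *] by (metis Range_iff UNIV_I cinner_zero_left)
    then show "f = g" using cinner_orthogonal_UNIV eq_iff_diff_eq_0 by blast
  qed
  have mem: "(resolvent T v h, h) \<in> op_shift T v" 
    if "Range (op_shift T v) = UNIV" "Range (op_shift T (cnj v)) = UNIV" for v h
    unfolding resolvent_def by (rule theI'[OF ex1[OF that]])
  have "bounded_clinear (resolvent T w)"
    by (rule bounded_clinear_if_adjoint[of _ "resolvent T (cnj w)"])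
      (metis cinner_op_shift_symmetric complex_cnj_cnj mem rg sym)
  then show ?thesis using ex1 rg by (simp add: resolvent_set_def)
qed

text \<open>The basic criterion for self-adjointness. Both density and
  \<open>op_adjoint T \<subseteq> T\<close> come from solving at \<open>w\<close> and showing that a
  vector is orthogonal to the full range at \<open>cnj w\<close>.\<close>

lemma self_adjoint_if_symmetric:
  fixes T :: "'a::chilbert_space op"
  assumes op: "is_operator T" and sym: "T \<subseteq> op_adjoint T"
    and rg: "Range (op_shift T w) = UNIV" "Range (op_shift T (cnj w)) = UNIV"
  shows "self_adjoint T"
proof -
  have "closure (Domain T) = UNIV"
  proof (rule closed_subspace_eq_UNIV)
    show "subspace (closure (Domain T))"
      unfolding Domain_fst using subspace_op[OF op]
      by (intro subspace_closure linear_subspace_image)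
        (simp_all add: bounded_linear.linear bounded_linear_fst)
    fix z assume z: "\<And>v. v \<in> closure (Domain T) \<Longrightarrow> inner z v = 0"
    \<comment> \<open>If \<open>z\<close> is orthogonal to the domain, its preimage \<open>f\<close>
      is orthogonal to the range of \<open>T - cnj w\<close>, so \<open>f\<close> and then
      \<open>z\<close> vanish.\<close>
    obtain f where f: "(f, z) \<in> op_shift T w" using rg(1) by blast
    have "cinner f k = 0" for k
    proof -
      obtain g where g: "(g, k) \<in> op_shift T (cnj w)" using rg(2) by blast
      then have "c *\<^sub>C g \<in> closure (Domain T)" for c
        using op_scale[OF op] by (intro subsetD[OF closure_subset] DomainI) simp
      then have "cinner z g = 0" using z by (intro cinner_eq_0_if_inner) blast
      then show ?thesis using cinner_op_shift_symmetric[OF sym f g] by simp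
    qed
    then have "f = 0" by (rule cinner_orthogonal_UNIV)
    then show "z = 0" using f op_unique[OF op] op_zero[OF op] by (metis mem_op_shift add_0_right scaleC_zero_right)
  qed simp
  moreover have "op_adjoint T \<subseteq> T"
  proof (rule subrelI)
    fix g h assume gh: "(g, h) \<in> op_adjoint T"
    \<comment> \<open>This \<open>f\<close> is the candidate in the domain of \<open>T\<close> that
      must coincide with \<open>g\<close>.\<close>
    obtain f where f: "(f, h - w *\<^sub>C g) \<in> op_shift T w" using rg(1) by blast
    have "cinner (g - f) k = 0" for k
    proof -
      obtain u where u: "(u, k) \<in> op_shift T (cnj w)" using rg(2) by blast
      have "cinner (k + cnj w *\<^sub>C u) g = cinner u h" using gh u by (auto simp: mem_op_adjoint)
      then have "cinner k g = cinner u (h - w *\<^sub>C g)"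
        by (simp add: cinner_simps eq_diff_eq)
      also have "\<dots> = cinner k f"
        using cinner_op_shift_symmetric[OF sym f u] by (metis cinner_commute)
      finally show ?thesis by (metis cinner_commute cinner_diff_left eq_iff_diff_eq_0)
    qed
    then have "g = f" using cinner_orthogonal_UNIV eq_iff_diff_eq_0 by blast
    then show "(g, h) \<in> T" using f by simp
  qed
  ultimately show ?thesis using assms by (auto simp: self_adjoint_def densely_defined_def)
qed

text \<open>The graph is closed, being an adjoint, and \<open>\<bar>Im w\<bar>\<close> is a lower
  bound. A vector orthogonal to the range would be an eigenvector of \<open>T\<close> for the
  nonreal \<open>cnj w\<close>, which the same bound excludes.\<close>

lemma Range_op_shift_eq_UNIV:
  fixes T :: "'a::chilbert_space op"
  assumes T: "self_adjoint T" and "Im w \<noteq> 0"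
  shows "Range (op_shift T w) = UNIV"
proof (rule Range_eq_UNIV_if_bounded_below)
  have op: "is_operator T" and sym: "T \<subseteq> op_adjoint T" and adj: "op_adjoint T = T"
    using T by (auto simp: self_adjoint_def)
  show "subspace (op_shift T w)" using op by (intro subspace_op is_operator_op_shift)
  show "closed (op_shift T w)" using closed_op_adjoint[of T] adj by (simp add: closed_op_shift)
  show "\<bar>Im w\<bar> > 0" using assms by simp
  show "\<bar>Im w\<bar> * norm f \<le> norm h" if "(f, h) \<in> op_shift T w" for f h
    using norm_op_shift_symmetric[OF sym that] .
  fix z assume z: "\<And>f h. (f, h) \<in> op_shift T w \<Longrightarrow> inner z h = 0"
  have "cinner f' z = cinner f (cnj w *\<^sub>C z)" if "(f, f') \<in> T" for f f'
  proof -
    have "(f, f' - w *\<^sub>C f) \<in> op_shift T w" using that by simp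
    then have "cinner z (f' - w *\<^sub>C f) = 0"
      using z op_scale[OF is_operator_op_shift[OF op]] by (intro cinner_eq_0_if_inner) blast
    then have "cinner (f' - w *\<^sub>C f) z = 0" by (metis cinner_commute complex_cnj_zero)
    then show ?thesis by (simp add: cinner_simps)
  qed
  then have "(z, cnj w *\<^sub>C z) \<in> T" using adj by (metis mem_op_adjoint)
  then have "\<bar>Im (cnj w)\<bar> * norm z \<le> norm (0::'a)"
    by (intro norm_op_shift_symmetric[OF sym]) simp
  then show "z = 0" using assms(2) by (simp add: mult_le_0_iff)
qed

lemma nonreal_in_resolvent_set:
  fixes T :: "'a::chilbert_space op"
  assumes "self_adjoint T" "Im w \<noteq> 0"
  shows "w \<in> resolvent_set T"
  using assms by (intro in_resolvent_set_if_symmetric Range_op_shift_eq_UNIV)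
    (auto simp: self_adjoint_def)

text \<open>The adjoint of the resolvent at \<open>w\<close> is a right inverse of
  \<open>T - cnj w\<close>: pairing its values with the domain of \<open>T\<close> places them in
  the domain of \<open>op_adjoint T = T\<close>.\<close>

lemma cnj_in_resolvent_set:
  fixes T :: "'a::chilbert_space op"
  assumes T: "self_adjoint T" and w: "w \<in> resolvent_set T"
  shows "cnj w \<in> resolvent_set T"
proof (rule in_resolvent_set_if_symmetric)
  show "is_operator T" "T \<subseteq> op_adjoint T" using T by (auto simp: self_adjoint_def)
  show "Range (op_shift T (cnj (cnj w))) = UNIV" using op_shift_resolvent[OF w] by (metis UNIV_eq_I Range.intros complex_cnj_cnj)
  have bR: "bounded_clinear (resolvent T w)" using w by (simp add: resolvent_set_def)
  have "(cadjoint (resolvent T w) h, h) \<in> op_shift T (cnj w)" for h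
  proof -
    define g where "g = cadjoint (resolvent T w) h"
    have "cinner f' g = cinner f (h + cnj w *\<^sub>C g)" if "(f, f') \<in> T" for f f'
    proof -
      have "resolvent T w (f' - w *\<^sub>C f) = f" using that by (intro resolvent_eqI[OF w]) simp
      then have "cinner f h = cinner (f' - w *\<^sub>C f) g"
        using cinner_cadjoint[OF bR, of "f' - w *\<^sub>C f" h] by (simp add: g_def)
      then show ?thesis by (simp add: cinner_simps)
    qed
    then have "(g, h + cnj w *\<^sub>C g) \<in> op_adjoint T" by (simp add: mem_op_adjoint)
    then show ?thesis using T by (simp add: self_adjoint_def g_def)
  qed
  then show "Range (op_shift T (cnj w)) = UNIV" by blast
qed

section \<open>Compact perturbations of the identity\<close>

lemma bounded_clinear_bounded_linear: "bounded_clinear f \<Longrightarrow> bounded_linear f"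
  by (simp add: bounded_clinear_def)

lemma bounded_clinear_scaleC: "bounded_clinear f \<Longrightarrow> f (c *\<^sub>C x) = c *\<^sub>C f x"
  by (simp add: bounded_clinear_def)

lemma bounded_clinear_linear: "bounded_clinear f \<Longrightarrow> linear f"
  by (rule bounded_linear.linear[OF bounded_clinear_bounded_linear])

lemmas bounded_clinear_add = linear_add[OF bounded_clinear_linear]
  and bounded_clinear_diff = linear_diff[OF bounded_clinear_linear]
  and bounded_clinear_minus = linear_neg[OF bounded_clinear_linear]
  and bounded_clinear_zero = linear_0[OF bounded_clinear_linear]

lemma bounded_clinear_compose:
  "bounded_clinear f \<Longrightarrow> bounded_clinear g \<Longrightarrow> bounded_clinear (\<lambda>x. f (g x))"
  by (simp add: bounded_clinear_def bounded_linear_compose)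

lemma bounded_clinear_ident: "bounded_clinear (\<lambda>x. x)"
  by (simp add: bounded_clinear_def bounded_linear_ident)

lemma bounded_clinear_plus:
  "bounded_clinear f \<Longrightarrow> bounded_clinear g \<Longrightarrow> bounded_clinear (\<lambda>x. f x + g x)"
  by (simp add: bounded_clinear_def bounded_linear_add scaleC_add_right)

lemma bounded_clinear_minus_fun:
  "bounded_clinear f \<Longrightarrow> bounded_clinear g \<Longrightarrow> bounded_clinear (\<lambda>x. f x - g x)"
  by (simp add: bounded_clinear_def bounded_linear_sub scaleC_diff_right)

text \<open>Bounded \<open>g\<close> maps the unit ball into a ball of radius \<open>C\<close>, so
  the image under \<open>f\<close> lies in \<open>C\<close> times a compact set.\<close>

lemma compact_operator_compose:
  fixes f :: "'b::complex_inner \<Rightarrow> 'c::complex_inner" and g :: "'a::complex_inner \<Rightarrow> 'b"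
  assumes K: "compact_operator f" and g: "bounded_clinear g"
  shows "compact_operator (\<lambda>x. f (g x))"
proof -
  have f: "bounded_clinear f" and cpt: "compact (closure (f ` cball 0 1))"
    using K by (auto simp: compact_operator_def)
  obtain C where C: "C > 0" "\<And>x. norm (g x) \<le> norm x * C"
    using bounded_linear.pos_bounded[OF bounded_clinear_bounded_linear[OF g]] by blast
  let ?S = "(\<lambda>y. C *\<^sub>R y) ` closure (f ` cball 0 1)"
  have "compact ?S" using cpt by (rule compact_scaling)
  moreover have "(\<lambda>x. f (g x)) ` cball 0 1 \<subseteq> ?S"
  proof (clarsimp)
    fix x :: 'a assume x: "norm x \<le> 1"
    have "norm (g x) \<le> 1 * C"
      using C(2)[of x] mult_right_mono[of "norm x" 1 C] C(1) x by linarith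
    then have "(1 / C) *\<^sub>R g x \<in> cball 0 1" using C(1) by (simp add: field_simps)
    then have "f ((1 / C) *\<^sub>R g x) \<in> closure (f ` cball 0 1)" 
      by (intro subsetD[OF closure_subset] imageI)
    moreover have "f (g x) = C *\<^sub>R f ((1 / C) *\<^sub>R g x)"
      using C(1) by (simp add: linear_scale[OF bounded_clinear_linear[OF f]])
    ultimately show "f (g x) \<in> ?S" by blast
  qed
  ultimately have "closure ((\<lambda>x. f (g x)) ` cball 0 1) \<subseteq> ?S"
    by (intro closure_minimal compact_imp_closed)
  then have "compact (closure ((\<lambda>x. f (g x)) ` cball 0 1))"
    using compact_Int_closed[OF \<open>compact ?S\<close> closed_closure] by (metis Int_absorb1)
  then show ?thesis using f g by (simp add: compact_operator_def bounded_clinear_compose)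
qed

text \<open>Otherwise there are unit vectors \<open>u n\<close> with \<open>u n + K (u n)\<close>
  tending to 0. Compactness makes a subsequence converge, to a unit vector in the kernel.\<close>

lemma bounded_below_id_plus_compact:
  fixes K :: "'a::complex_inner \<Rightarrow> 'a"
  assumes K: "compact_operator K" and inj: "\<And>x. x + K x = 0 \<Longrightarrow> x = 0"
  shows "\<exists>c>0. \<forall>x. c * norm x \<le> norm (x + K x)"
proof (rule ccontr)
  assume neg: "\<not> ?thesis"
  have bc: "bounded_clinear K" and cpt: "compact (closure (K ` cball 0 1))"
    using K by (auto simp: compact_operator_def)
  note bl = bounded_clinear_bounded_linear[OF bc]
  have "\<exists>u. norm u = 1 \<and> norm (u + K u) < inverse (real (Suc n))" for n
  proof -
    obtain x where x: "norm (x + K x) < inverse (real (Suc n)) * norm x"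
      using neg[simplified, rule_format, of "inverse (real (Suc n))"] by (auto simp: not_le)
    then have "x \<noteq> 0" by auto
    define u where "u = (1 / norm x) *\<^sub>R x"
    have "u + K u = (1 / norm x) *\<^sub>R (x + K x)"
      unfolding u_def using bl by (simp add: linear_scale bounded_linear.linear scaleR_add_right)
    then have "norm (u + K u) < inverse (real (Suc n))"
      using x \<open>x \<noteq> 0\<close> by (simp add: pos_divide_less_eq)
    moreover have "norm u = 1" using \<open>x \<noteq> 0\<close> by (simp add: u_def)
    ultimately show ?thesis by blast
  qed
  then obtain u where u: "\<And>n. norm (u n) = 1" "\<And>n. norm (u n + K (u n)) < inverse (real (Suc n))"
    by metis
  have lim0: "(\<lambda>n. u n + K (u n)) \<longlonglongrightarrow> 0"
    using u(2) by (intro Lim_null_comparison[OF _ LIMSEQ_inverse_real_of_nat])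
      (auto intro: always_eventually less_imp_le)
  have "K (u n) \<in> closure (K ` cball 0 1)" for n
    using u(1)[of n] by (intro subsetD[OF closure_subset]) auto
  then obtain l r where r: "strict_mono (r :: nat \<Rightarrow> nat)" and l: "(\<lambda>n. K (u (r n))) \<longlonglongrightarrow> l"
    using cpt unfolding compact_def comp_def by meson
  have "(\<lambda>n. (u (r n) + K (u (r n))) - K (u (r n))) \<longlonglongrightarrow> 0 - l"
    using LIMSEQ_subseq_LIMSEQ[OF lim0 r] l unfolding comp_def by (rule tendsto_diff)
  then have ul: "(\<lambda>n. u (r n)) \<longlonglongrightarrow> - l" by simp
  \<comment> \<open>By continuity \<open>K (u (r n))\<close> tends to \<open>K (- l)\<close>, while
    \<open>l\<close> is its limit by choice.\<close>
  have "K (- l) = l"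
    using bounded_linear.tendsto[OF bl ul] l by (rule LIMSEQ_unique)
  then have "- l = 0" using inj[of "- l"] by simp
  moreover have "norm (- l) = 1"
    using tendsto_norm[OF ul] u(1) by (simp add: LIMSEQ_const_iff)
  ultimately show False by simp
qed

lemma boundedly_invertibleI_below:
  fixes F :: "'a::complex_inner \<Rightarrow> 'b::complex_inner"
  assumes F: "bounded_clinear F" and "surj F" and "c > 0" and below: "\<And>x. c * norm x \<le> norm (F x)"
  shows "boundedly_invertible F"
proof -
  have "inj F"
  proof (rule injI)
    fix x y assume "F x = F y"
    then have "c * norm (x - y) \<le> 0" using below[of "x - y"] F by (simp add: bounded_clinear_diff)
    then show "x = y" using \<open>c > 0\<close> by (simp add: mult_le_0_iff)
  qed
  then have inv: "inv F (F x) = x" for x by simp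
  have Finv: "F (inv F y) = y" for y using \<open>surj F\<close> by (rule surj_f_inv_f)
  note bl = bounded_clinear_bounded_linear[OF F]
  have "bounded_linear (inv F)"
  proof (rule bounded_linear_intro[where K = "1 / c"])
    fix x y r
    have "F (inv F x + inv F y) = x + y" using F by (simp add: bounded_clinear_add Finv)
    then show "inv F (x + y) = inv F x + inv F y" using inv by metis
    have "F (r *\<^sub>R inv F x) = r *\<^sub>R x" using bl by (simp add: linear_scale bounded_linear.linear Finv)
    then show "inv F (r *\<^sub>R x) = r *\<^sub>R inv F x" using inv by metis
    show "norm (inv F x) \<le> norm x * (1 / c)"
      using below[of "inv F x"] \<open>c > 0\<close> by (simp add: Finv field_simps)
  qed
  moreover have "inv F (a *\<^sub>C y) = a *\<^sub>C inv F y" for a y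
    using inv[of "a *\<^sub>C inv F y"] F by (simp add: bounded_clinear_scaleC Finv)
  ultimately show ?thesis
    using \<open>inj F\<close> \<open>surj F\<close> by (simp add: boundedly_invertible_def bounded_clinear_def bij_def)
qed

text \<open>With an adjoint of \<open>K\<close> at hand, surjectivity in the Fredholm alternative
  only requires that the range is closed, which the lower bound yields.\<close>

lemma boundedly_invertible_id_plus_compact:
  fixes K :: "'a::chilbert_space \<Rightarrow> 'a"
  assumes K: "compact_operator K" and adj: "\<And>x y. cinner (K x) y = cinner x (L y)"
    and injK: "\<And>x. x + K x = 0 \<Longrightarrow> x = 0" and injL: "\<And>x. x + L x = 0 \<Longrightarrow> x = 0"
  shows "boundedly_invertible (\<lambda>x. x + K x)"
proof -
  let ?F = "\<lambda>x. x + K x"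
  \<comment> \<open>The graph of \<open>?F\<close>, to which the closed range argument for operators
    applies.\<close>
  let ?T = "{p. snd p = ?F (fst p)}"
  obtain c where c: "c > 0" "\<And>x. c * norm x \<le> norm (?F x)"
    using bounded_below_id_plus_compact[OF K injK] by blast
  have F: "bounded_clinear ?F"
    using K by (simp add: compact_operator_def bounded_clinear_plus bounded_clinear_ident)
  have blK: "bounded_linear K"
    using K by (simp add: compact_operator_def bounded_clinear_bounded_linear)
  have "Range ?T = UNIV"
  proof (rule Range_eq_UNIV_if_bounded_below[OF _ _ c(1)])
    show "subspace ?T"
      using bounded_linear.linear[OF blK]
      by (simp add: subspace_def linear_0 linear_add linear_scale scaleR_add_right)
    show "closed ?T"
      by (intro closed_Collect_eq continuous_on_snd continuous_on_add continuous_on_fst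
          continuous_on_id bounded_linear.continuous_on[OF blK])
    show "c * norm f \<le> norm h" if "(f, h) \<in> ?T" for f h using that c(2) by simp
    fix z assume z: "\<And>f h. (f, h) \<in> ?T \<Longrightarrow> inner z h = 0"
    have "cinner (?F x) z = 0" for x
    proof -
      have "c *\<^sub>C ?F x = ?F (c *\<^sub>C x)" for c by (rule bounded_clinear_scaleC[OF F, symmetric])
      then have "cinner z (?F x) = 0" using z by (intro cinner_eq_0_if_inner) simp
      then show ?thesis by (metis cinner_commute complex_cnj_zero)
    qed
    then have "cinner x (z + L z) = 0" for x by (simp add: cinner_simps adj)
    then have "z + L z = 0" using cinner_self_eq_0 by blast
    then show "z = 0" by (rule injL)
  qed
  then have "surj ?F" by (force simp: Range_iff set_eq_iff surj_def)
  then show ?thesis using boundedly_invertibleI_below[OF F _ c] by blast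
qed

text \<open>The inverse of \<open>I + P Q\<close> is \<open>I - P (I + Q P)^(-1) Q\<close>. This
  carries invertibility from \<open>\<G>\<close> to \<open>\<K>\<close>, the two spaces between
  which \<open>B1\<close> and \<open>B2\<close> act.\<close>

lemma boundedly_invertible_id_plus_swap:
  assumes P: "bounded_clinear P" and Q: "bounded_clinear Q"
    and inv: "boundedly_invertible (\<lambda>x. x + Q (P x))"
  shows "boundedly_invertible (\<lambda>y. y + P (Q y))"
proof -
  let ?F = "\<lambda>x. x + Q (P x)" and ?G = "\<lambda>y. y + P (Q y)"
  let ?N = "\<lambda>y. y - P (inv ?F (Q y))"
  have bij: "bij ?F" and V: "bounded_clinear (inv ?F)"
    using inv by (auto simp: boundedly_invertible_def)
  have FV: "inv ?F x + Q (P (inv ?F x)) = x" for x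
    using surj_f_inv_f[OF bij_is_surj[OF bij]] .
  have VF: "inv ?F (x + Q (P x)) = x" for x
    using inv_f_f[OF bij_is_inj[OF bij]] .
  have "?G (?N y) = y" for y
  proof -
    have "?G (?N y) = y + P (Q y) - P (inv ?F (Q y) + Q (P (inv ?F (Q y))))"
      by (simp add: bounded_clinear_add[OF P] bounded_clinear_diff[OF P] bounded_clinear_diff[OF Q])
    then show ?thesis by (simp add: FV)
  qed
  then have "?G \<circ> ?N = id" by (simp add: fun_eq_iff)
  moreover have "?N (?G y) = y" for y
    \<comment> \<open>Here \<open>Q (?G y) = ?F (Q y)\<close>, so the inverse of \<open>?F\<close>
      returns \<open>Q y\<close>.\<close>
    using VF[of "Q y"] by (simp add: bounded_clinear_add[OF Q])
  then have "?N \<circ> ?G = id" by (simp add: fun_eq_iff)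
  ultimately have "bij ?G" "inv ?G = ?N"
    by (auto intro: o_bij inv_unique_comp)
  moreover have "bounded_clinear ?N"
    by (intro bounded_clinear_minus_fun bounded_clinear_ident bounded_clinear_compose[OF P]
        bounded_clinear_compose[OF V] Q)
  ultimately show ?thesis by (simp add: boundedly_invertible_def)
qed

section \<open>Boundary triples\<close>

locale boundary_triple =
  fixes A :: "'h::chilbert_space op"
    and \<Gamma>0 \<Gamma>1 :: "'h \<Rightarrow> 'g::chilbert_space"
  assumes op_A: "is_operator A"
    and clinear0: "clinear_on (Domain A) \<Gamma>0" and clinear1: "clinear_on (Domain A) \<Gamma>1"
    and self_adjoint_A0: "self_adjoint (op_A0 A \<Gamma>0)"
    and surj_Gamma0: "\<Gamma>0 ` Domain A = UNIV"
    and green: "(f, f') \<in> A \<Longrightarrow> (g, g') \<in> A \<Longrightarrow>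
      cinner f' g - cinner f g' = cinner (\<Gamma>1 f) (\<Gamma>0 g) - cinner (\<Gamma>0 f) (\<Gamma>1 g)"
begin

abbreviation A0 where "A0 \<equiv> op_A0 A \<Gamma>0"
abbreviation \<gamma> where "\<gamma> \<equiv> gamma_field A \<Gamma>0"
abbreviation M where "M \<equiv> weyl_function A \<Gamma>0 \<Gamma>1"

lemma Gamma_add:
  assumes "(f, f') \<in> A" "(g, g') \<in> A"
  shows "\<Gamma>0 (f + g) = \<Gamma>0 f + \<Gamma>0 g" "\<Gamma>1 (f + g) = \<Gamma>1 f + \<Gamma>1 g"
  using DomainI[OF assms(1)] DomainI[OF assms(2)] clinear0 clinear1
  by (simp_all add: clinear_on_def)

lemma Gamma_scale:
  assumes "(f, f') \<in> A"
  shows "\<Gamma>0 (c *\<^sub>C f) = c *\<^sub>C \<Gamma>0 f" "\<Gamma>1 (c *\<^sub>C f) = c *\<^sub>C \<Gamma>1 f"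
  using DomainI[OF assms] clinear0 clinear1 by (simp_all add: clinear_on_def)

lemma Gamma_diff:
  assumes "(f, f') \<in> A" "(g, g') \<in> A"
  shows "\<Gamma>0 (f - g) = \<Gamma>0 f - \<Gamma>0 g" "\<Gamma>1 (f - g) = \<Gamma>1 f - \<Gamma>1 g"
  using Gamma_add[OF assms(1) op_scale[OF op_A assms(2), of "-1"]] Gamma_scale[OF assms(2), of "-1"]
  by (simp_all add: scaleC_minus_one)

lemma Gamma_zero: "\<Gamma>0 0 = 0" "\<Gamma>1 0 = 0"
  using Gamma_scale[OF op_zero[OF op_A], of 0] by simp_all

lemma mem_A0: "(f, f') \<in> A0 \<longleftrightarrow> (f, f') \<in> A \<and> \<Gamma>0 f = 0"
  by (auto simp: op_A0_def op_restrict_def)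

lemma
  assumes "w \<in> resolvent_set A0"
  shows resolvent_A0_mem: "(resolvent A0 w h, h + w *\<^sub>C resolvent A0 w h) \<in> A"
    and Gamma0_resolvent_A0: "\<Gamma>0 (resolvent A0 w h) = 0"
  using op_shift_resolvent[OF assms, of h] by (simp_all add: mem_A0)

text \<open>The difference lies in \<open>Ker (A0 - w)\<close>, which is trivial. Together with the
  next lemma this expresses the direct sum decomposition of the domain of \<open>A\<close>.\<close>

lemma Gamma0_inj_on_ker:
  assumes w: "w \<in> resolvent_set A0" and "(f, w *\<^sub>C f) \<in> A" "(g, w *\<^sub>C g) \<in> A" "\<Gamma>0 f = \<Gamma>0 g"
  shows "f = g"
proof -
  have "(f - g, 0) \<in> op_shift A0 w"
    using op_diff[OF op_A assms(2,3)] Gamma_diff[OF assms(2,3)] assms(4)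
    by (simp add: mem_A0 scaleC_diff_right)
  moreover have "(0, 0) \<in> op_shift A0 w" using op_zero[OF op_A] by (simp add: mem_A0 Gamma_zero)
  ultimately have "f - g = 0" using resolvent_eqI[OF w] by metis
  then show ?thesis by simp
qed

lemma ex_ker_Gamma0:
  assumes w: "w \<in> resolvent_set A0"
  shows "\<exists>f. (f, w *\<^sub>C f) \<in> A \<and> \<Gamma>0 f = \<phi>"
proof -
  obtain u u' where u: "(u, u') \<in> A" "\<Gamma>0 u = \<phi>" using surj_Gamma0 by (metis DomainE UNIV_I imageE)
  \<comment> \<open>Subtracting \<open>r\<close> from the preimage \<open>u\<close> cancels
    \<open>(A - w) u\<close> and leaves \<open>\<Gamma>0 u\<close> unchanged.\<close>
  define r where "r = resolvent A0 w (u' - w *\<^sub>C u)"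
  have r: "(r, u' - w *\<^sub>C u + w *\<^sub>C r) \<in> A" "\<Gamma>0 r = 0"
    unfolding r_def using resolvent_A0_mem[OF w] Gamma0_resolvent_A0[OF w] by auto
  have "(u - r, w *\<^sub>C (u - r)) \<in> A"
    using op_diff[OF op_A u(1) r(1)] by (simp add: scaleC_diff_right)
  then show ?thesis using Gamma_diff[OF u(1) r(1)] u r by auto
qed

lemma
  assumes w: "w \<in> resolvent_set A0"
  shows gamma_mem: "(\<gamma> w \<phi>, w *\<^sub>C \<gamma> w \<phi>) \<in> A"
    and Gamma0_gamma: "\<Gamma>0 (\<gamma> w \<phi>) = \<phi>"
proof -
  have "\<phi> \<in> \<Gamma>0 ` op_ker (op_shift A w)"
    using ex_ker_Gamma0[OF w, of \<phi>] by (auto simp: op_ker_def)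
  from inv_into_into[OF this] f_inv_into_f[OF this]
  show "(\<gamma> w \<phi>, w *\<^sub>C \<gamma> w \<phi>) \<in> A" "\<Gamma>0 (\<gamma> w \<phi>) = \<phi>"
    by (auto simp: gamma_field_def op_ker_def)
qed

lemma gamma_Gamma0:
  assumes "w \<in> resolvent_set A0" "(f, w *\<^sub>C f) \<in> A"
  shows "\<gamma> w (\<Gamma>0 f) = f"
  using Gamma0_inj_on_ker[OF assms(1) gamma_mem[OF assms(1)] assms(2)] Gamma0_gamma[OF assms(1)] by blast

lemma Gamma1_gamma: "\<Gamma>1 (\<gamma> w \<phi>) = M w \<phi>"
  by (simp add: weyl_function_def)

section \<open>Adjoints and boundedness of the gamma field and the Weyl function\<close>

lemma cnj_in_resolvent_set_A0: "w \<in> resolvent_set A0 \<Longrightarrow> cnj w \<in> resolvent_set A0"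
  using cnj_in_resolvent_set[OF self_adjoint_A0] .

text \<open>Green's identity for \<open>\<gamma> (cnj w) \<phi>\<close> and
  \<open>resolvent A0 w h\<close>: the terms with \<open>w\<close> cancel, and one boundary term
  vanishes because \<open>\<Gamma>0\<close> kills the resolvent.\<close>

lemma cinner_gamma:
  assumes w: "w \<in> resolvent_set A0"
  shows "cinner (\<gamma> (cnj w) \<phi>) h = cinner \<phi> (\<Gamma>1 (resolvent A0 w h))"
  using green[OF gamma_mem[OF cnj_in_resolvent_set_A0[OF w]] resolvent_A0_mem[OF w], of \<phi> h]
  by (simp add: Gamma0_resolvent_A0[OF w] Gamma0_gamma[OF cnj_in_resolvent_set_A0[OF w]] cinner_simps)

lemma bounded_clinear_gamma:
  assumes "w \<in> resolvent_set A0"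
  shows "bounded_clinear (\<gamma> w)"
  using bounded_clinear_if_adjoint[OF cinner_gamma[OF cnj_in_resolvent_set_A0[OF assms]]] by simp

lemma cadjoint_gamma:
  assumes "w \<in> resolvent_set A0"
  shows "cadjoint (\<gamma> (cnj w)) = (\<lambda>h. \<Gamma>1 (resolvent A0 w h))"
  by (rule cadjoint_eqI[OF cinner_gamma[OF assms]])

text \<open>For elements of \<open>Ker (A - w)\<close> and \<open>Ker (A - cnj w)\<close> the left
  side of Green's identity is zero.\<close>

lemma cinner_M:
  assumes w: "w \<in> resolvent_set A0"
  shows "cinner (M w \<phi>) \<psi> = cinner \<phi> (M (cnj w) \<psi>)"
  using green[OF gamma_mem[OF w] gamma_mem[OF cnj_in_resolvent_set_A0[OF w]], of \<phi> \<psi>]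
  by (simp add: Gamma0_gamma w cnj_in_resolvent_set_A0 Gamma1_gamma cinner_simps)

lemma bounded_clinear_M: "w \<in> resolvent_set A0 \<Longrightarrow> bounded_clinear (M w)"
  by (rule bounded_clinear_if_adjoint[OF cinner_M])

end

section \<open>The perturbed operator \<open>AB\<close>\<close>

locale perturbed_boundary_triple = boundary_triple A \<Gamma>0 \<Gamma>1
  for A :: "'h::chilbert_space op" and \<Gamma>0 \<Gamma>1 :: "'h \<Rightarrow> 'g::chilbert_space" +
  fixes B1 :: "'k::chilbert_space \<Rightarrow> 'g" and B2 :: "'g \<Rightarrow> 'k"
  assumes B1: "bounded_clinear B1" and B2: "bounded_clinear B2"
    and compact_B: "compact_operator (B1 \<circ> B2)"
    and cinner_B: "cinner (B1 (B2 \<phi>)) \<psi> = cinner \<phi> (B1 (B2 \<psi>))"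
begin

abbreviation AB where "AB \<equiv> op_AB A \<Gamma>0 \<Gamma>1 (B1 \<circ> B2)"
abbreviation W where "W \<equiv> weyl_perturbation A \<Gamma>0 \<Gamma>1 B1 B2"

lemma W_eq: "W w x = x + B2 (M w (B1 x))"
  by (simp add: weyl_perturbation_def)

lemma mem_AB: "(f, f') \<in> AB \<longleftrightarrow> (f, f') \<in> A \<and> \<Gamma>0 f + B1 (B2 (\<Gamma>1 f)) = 0"
  by (auto simp: op_AB_def op_restrict_def)

lemmas B_simps = bounded_clinear_add[OF B1] bounded_clinear_add[OF B2]
  bounded_clinear_diff[OF B1] bounded_clinear_diff[OF B2]
  bounded_clinear_minus[OF B1] bounded_clinear_minus[OF B2]
  bounded_clinear_scaleC[OF B1] bounded_clinear_scaleC[OF B2]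
  bounded_clinear_zero[OF B1] bounded_clinear_zero[OF B2]

lemma op_AB: "is_operator AB"
  unfolding is_operator_def
proof (intro conjI allI impI)
  show "single_valued AB"
    using op_unique[OF op_A] by (auto simp: single_valued_def mem_AB)
  show "(0, 0) \<in> AB" using op_zero[OF op_A] by (simp add: mem_AB Gamma_zero B_simps)
  fix f f' g g' c
  assume f: "(f, f') \<in> AB"
  then have fA: "(f, f') \<in> A" by (simp add: mem_AB)
  show "(c *\<^sub>C f, c *\<^sub>C f') \<in> AB"
    using f by (simp add: mem_AB op_scale[OF op_A fA] Gamma_scale[OF fA] B_simps flip: scaleC_add_right)
  assume g: "(g, g') \<in> AB"
  then have gA: "(g, g') \<in> A" by (simp add: mem_AB)
  have "\<Gamma>0 (f + g) + B1 (B2 (\<Gamma>1 (f + g)))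
      = (\<Gamma>0 f + B1 (B2 (\<Gamma>1 f))) + (\<Gamma>0 g + B1 (B2 (\<Gamma>1 g)))"
    by (simp add: Gamma_add[OF fA gA] B_simps)
  then show "(f + g, f' + g') \<in> AB"
    using f g by (simp add: mem_AB op_add[OF op_A])
qed

text \<open>Substituting \<open>\<Gamma>0 = - B \<Gamma>1\<close> into Green's identity leaves two
  terms that cancel because \<open>B\<close> is symmetric.\<close>

lemma symmetric_AB: "AB \<subseteq> op_adjoint AB"
proof (rule subrelI)
  fix g g' assume g: "(g, g') \<in> AB"
  have "cinner f' g = cinner f g'" if f: "(f, f') \<in> AB" for f f'
  proof -
    have eqs: "\<Gamma>0 g = - B1 (B2 (\<Gamma>1 g))" "\<Gamma>0 f = - B1 (B2 (\<Gamma>1 f))"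
      using f g by (auto simp: mem_AB eq_neg_iff_add_eq_0)
    have "cinner f' g - cinner f g' = cinner (\<Gamma>1 f) (\<Gamma>0 g) - cinner (\<Gamma>0 f) (\<Gamma>1 g)"
      using f g by (intro green) (auto simp: mem_AB)
    also have "\<dots> = 0" unfolding eqs by (simp add: cinner_simps cinner_B)
    finally show ?thesis by simp
  qed
  then show "(g, g') \<in> op_adjoint AB" by (simp add: mem_op_adjoint)
qed

section \<open>Kernel and point spectrum of \<open>AB\<close> over the resolvent set of
  \<open>A0\<close>\<close>

lemma gamma_mem_AB:
  assumes "w \<in> resolvent_set A0"
  shows "(\<gamma> w \<phi>, w *\<^sub>C \<gamma> w \<phi>) \<in> AB \<longleftrightarrow> \<phi> + B1 (B2 (M w \<phi>)) = 0"
  by (simp add: mem_AB gamma_mem[OF assms] Gamma0_gamma[OF assms] Gamma1_gamma)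

lemma ker_AB:
  assumes w: "w \<in> resolvent_set A0"
  shows "op_ker (op_shift AB w) = (\<gamma> w \<circ> B1) ` op_ker (op_of_fun (W w))"
proof (intro set_eqI iffI)
  fix f assume "f \<in> op_ker (op_shift AB w)"
  then have f: "(f, w *\<^sub>C f) \<in> AB" by (simp add: op_ker_def)
  define \<phi> where "\<phi> = \<Gamma>0 f"
  have f\<phi>: "f = \<gamma> w \<phi>" using f gamma_Gamma0[OF w] by (simp add: mem_AB \<phi>_def)
  then have *: "\<phi> + B1 (B2 (M w \<phi>)) = 0" using f gamma_mem_AB[OF w] by simp
  \<comment> \<open>The equation for \<open>\<phi>\<close> says \<open>\<phi> = B1 x\<close> for
    this \<open>x\<close>; inserting \<open>B1 x = \<phi>\<close> into \<open>W w x\<close> then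
    gives zero.\<close>
  define x where "x = - B2 (M w \<phi>)"
  have "B1 x = \<phi>" using * by (simp add: x_def B_simps eq_neg_iff_add_eq_0 neg_eq_iff_add_eq_0 add.commute)
  then have "W w x = 0" by (simp add: W_eq) (simp add: x_def)
  then have "x \<in> op_ker (op_of_fun (W w))" by (simp add: op_ker_def op_of_fun_def)
  then show "f \<in> (\<gamma> w \<circ> B1) ` op_ker (op_of_fun (W w))" using f\<phi> \<open>B1 x = \<phi>\<close> by auto
next
  fix f assume "f \<in> (\<gamma> w \<circ> B1) ` op_ker (op_of_fun (W w))"
  then obtain x where f: "f = \<gamma> w (B1 x)" and "W w x = 0" by (auto simp: op_ker_def op_of_fun_def)
  then have "B1 (x + B2 (M w (B1 x))) = 0" by (simp add: W_eq B_simps)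
  then have "(f, w *\<^sub>C f) \<in> AB" unfolding f by (simp add: gamma_mem_AB[OF w] B_simps)
  then show "f \<in> op_ker (op_shift AB w)" by (simp add: op_ker_def)
qed

text \<open>On the kernel of \<open>W w\<close> the map \<open>\<gamma> w \<circ> B1\<close> is
  injective: \<open>\<Gamma>0\<close> recovers \<open>B1 x\<close>, and if that is zero then
  \<open>W w x = 0\<close> reduces to \<open>x = 0\<close>.\<close>

lemma point_spectrum_AB_iff:
  assumes w: "w \<in> resolvent_set A0"
  shows "w \<in> point_spectrum AB \<longleftrightarrow> 0 \<in> point_spectrum (op_of_fun (W w))"
proof -
  have "\<gamma> w (B1 x) = 0 \<longleftrightarrow> x = 0" if "W w x = 0" for x
  proof
    assume "\<gamma> w (B1 x) = 0"
    then have "B1 x = 0" using Gamma0_gamma[OF w, of "B1 x"] Gamma_zero by simp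
    then show "x = 0"
      using that by (simp add: W_eq B_simps bounded_clinear_zero[OF bounded_clinear_M[OF w]])
  qed (simp add: B_simps bounded_clinear_zero[OF bounded_clinear_gamma[OF w]])
  moreover have "op_shift (op_of_fun (W w)) 0 = op_of_fun (W w)" by (auto simp: op_shift_def)
  ultimately show ?thesis
    unfolding point_spectrum_def mem_Collect_eq ker_AB[OF w]
    by (auto simp: op_ker_def op_of_fun_def)
qed

text \<open>A real \<open>w\<close> is its own conjugate, and a symmetric operator has no nonreal
  eigenvalues.\<close>

lemma cnj_notin_point_spectrum_AB:
  assumes "w \<notin> point_spectrum AB"
  shows "cnj w \<notin> point_spectrum AB"
proof (cases "Im w = 0")
  case True
  then have "cnj w = w" by (simp add: complex_eq_iff)
  then show ?thesis using assms by simp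
next
  case False
  show ?thesis
  proof
    assume "cnj w \<in> point_spectrum AB"
    then obtain f where "f \<noteq> 0" "(f, 0) \<in> op_shift AB (cnj w)"
      by (auto simp: point_spectrum_def op_ker_def)
    then have "\<bar>Im (cnj w)\<bar> * norm f \<le> norm (0::'h)"
      using norm_op_shift_symmetric[OF symmetric_AB] by blast
    then show False using False \<open>f \<noteq> 0\<close> by (simp add: mult_le_0_iff)
  qed
qed

section \<open>Invertibility of \<open>W w\<close> and the resolvent of \<open>AB\<close>\<close>

lemma id_plus_BM_inj:
  assumes w: "w \<in> resolvent_set A0" "w \<notin> point_spectrum AB" and "\<phi> + B1 (B2 (M w \<phi>)) = 0"
  shows "\<phi> = 0"
proof -
  have "\<gamma> w \<phi> \<in> op_ker (op_shift AB w)"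
    using assms gamma_mem_AB by (simp add: op_ker_def)
  then have "\<gamma> w \<phi> = 0" using w(2) by (auto simp: point_spectrum_def)
  then show ?thesis using Gamma0_gamma[OF w(1), of \<phi>] Gamma_zero by simp
qed

text \<open>The adjoint \<open>I + M(cnj w) B\<close> of \<open>I + B M(w)\<close> is injective because \<open>B\<close> maps its kernel
  into that of \<open>I + B M(cnj w)\<close>.\<close>

lemma boundedly_invertible_W:
  assumes w: "w \<in> resolvent_set A0" "w \<notin> point_spectrum AB"
  shows "boundedly_invertible (W w)"
proof -
  note M = bounded_clinear_M[OF w(1)]
  note cw = cnj_in_resolvent_set_A0[OF w(1)] cnj_notin_point_spectrum_AB[OF w(2)]
  have "boundedly_invertible (\<lambda>\<phi>. \<phi> + B1 (B2 (M w \<phi>)))"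
  proof (rule boundedly_invertible_id_plus_compact[where L = "\<lambda>\<psi>. M (cnj w) (B1 (B2 \<psi>))"])
    show "compact_operator (\<lambda>\<phi>. B1 (B2 (M w \<phi>)))"
      using compact_operator_compose[OF compact_B M] by simp
    show "cinner (B1 (B2 (M w \<phi>))) \<psi> = cinner \<phi> (M (cnj w) (B1 (B2 \<psi>)))" for \<phi> \<psi>
      by (simp add: cinner_B cinner_M[OF w(1)])
    show "\<phi> = 0" if "\<phi> + B1 (B2 (M w \<phi>)) = 0" for \<phi>
      using id_plus_BM_inj[OF w that] .
    fix \<psi> assume \<psi>: "\<psi> + M (cnj w) (B1 (B2 \<psi>)) = 0"
    have "B1 (B2 \<psi>) + B1 (B2 (M (cnj w) (B1 (B2 \<psi>)))) = B1 (B2 (\<psi> + M (cnj w) (B1 (B2 \<psi>))))"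
      by (simp add: B_simps)
    also have "\<dots> = 0" unfolding \<psi> by (simp add: B_simps)
    finally have "B1 (B2 \<psi>) = 0" by (rule id_plus_BM_inj[OF cw])
    then show "\<psi> = 0"
      using \<psi> by (simp add: bounded_clinear_zero[OF bounded_clinear_M[OF cw(1)]])
  qed
  \<comment> \<open>The swap is applied with \<open>P = B2 M(w)\<close> and
    \<open>Q = B1\<close>.\<close>
  then have "boundedly_invertible (\<lambda>x. x + B2 (M w (B1 x)))"
    using boundedly_invertible_id_plus_swap[OF bounded_clinear_compose[OF B2 M] B1] by simp
  then show ?thesis by (simp add: weyl_perturbation_def)
qed

text \<open>For any \<open>\<phi>\<close>, \<open>r - \<gamma> w \<phi>\<close> with
  \<open>r = resolvent A0 w h\<close> solves \<open>(A - w) f = h\<close>. The boundary condition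
  requires \<open>\<phi> + B M(w) \<phi> = B \<Gamma>1 r\<close>, and \<open>\<phi> = B1 x\<close>
  with \<open>W w x = B2 (\<Gamma>1 r)\<close> satisfies it.\<close>

lemma krein_solution:
  assumes w: "w \<in> resolvent_set A0" and inv: "boundedly_invertible (W w)"
  shows "(resolvent A0 w h - \<gamma> w (B1 (inv (W w) (B2 (\<Gamma>1 (resolvent A0 w h))))), h) \<in> op_shift AB w"
proof -
  define r where "r = resolvent A0 w h"
  define x where "x = inv (W w) (B2 (\<Gamma>1 r))"
  have "W w x = B2 (\<Gamma>1 r)"
    unfolding x_def
    using inv surj_f_inv_f[of "W w"] by (simp add: boundedly_invertible_def bij_is_surj)
  then have x: "x = B2 (\<Gamma>1 r) - B2 (M w (B1 x))" by (simp add: W_eq eq_diff_eq)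
  have r: "(r, h + w *\<^sub>C r) \<in> A" "\<Gamma>0 r = 0"
    unfolding r_def using resolvent_A0_mem[OF w] Gamma0_resolvent_A0[OF w] by auto
  note g = gamma_mem[OF w, of "B1 x"]
  have "(r - \<gamma> w (B1 x), h + w *\<^sub>C (r - \<gamma> w (B1 x))) \<in> A"
    using op_diff[OF op_A r(1) g] by (simp add: scaleC_diff_right add_diff_eq)
  moreover have "\<Gamma>0 (r - \<gamma> w (B1 x)) + B1 (B2 (\<Gamma>1 (r - \<gamma> w (B1 x))))
      = - B1 x + B1 (B2 (\<Gamma>1 r) - B2 (M w (B1 x)))"
    by (simp add: Gamma_diff[OF r(1) g] Gamma0_gamma[OF w] Gamma1_gamma r(2) B_simps)
  then have "\<Gamma>0 (r - \<gamma> w (B1 x)) + B1 (B2 (\<Gamma>1 (r - \<gamma> w (B1 x)))) = 0"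
    using x by simp
  ultimately show ?thesis by (simp add: mem_AB r_def x_def)
qed

lemma Range_op_shift_AB:
  assumes "w \<in> resolvent_set A0" "w \<notin> point_spectrum AB"
  shows "Range (op_shift AB w) = UNIV"
  using krein_solution[OF assms(1) boundedly_invertible_W[OF assms]] by blast

lemma in_resolvent_set_AB:
  assumes "w \<in> resolvent_set A0" "w \<notin> point_spectrum AB"
  shows "w \<in> resolvent_set AB"
  by (rule in_resolvent_set_if_symmetric[OF op_AB symmetric_AB Range_op_shift_AB
        Range_op_shift_AB[OF cnj_in_resolvent_set_A0 cnj_notin_point_spectrum_AB]]) fact+

lemma self_adjoint_AB: "self_adjoint AB"
proof -
  have "\<i> \<notin> point_spectrum AB"
    \<comment> \<open>With \<open>h = 0\<close> and \<open>Im \<i> = 1\<close> the bound reads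
      \<open>norm f \<le> 0\<close>.\<close>
    using norm_op_shift_symmetric[OF symmetric_AB, of _ 0 \<i>]
    by (auto simp: point_spectrum_def op_ker_def)
  moreover have "\<i> \<in> resolvent_set A0"
    by (rule nonreal_in_resolvent_set[OF self_adjoint_A0]) simp
  ultimately show ?thesis
    by - (rule self_adjoint_if_symmetric[OF op_AB symmetric_AB Range_op_shift_AB
          Range_op_shift_AB[OF cnj_in_resolvent_set_A0 cnj_notin_point_spectrum_AB]])
qed

lemma resolvent_AB:
  assumes w: "w \<in> resolvent_set AB" "w \<in> resolvent_set A0"
  shows "resolvent AB w h
    = resolvent A0 w h - \<gamma> w (B1 (inv (W w) (B2 (cadjoint (\<gamma> (cnj w)) h))))"
proof (rule resolvent_eqI[OF w(1)])
  have "w \<notin> point_spectrum AB" using not_in_point_spectrum_if_resolvent_set[OF op_AB w(1)] .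
  then have "boundedly_invertible (W w)" by (rule boundedly_invertible_W[OF w(2)])
  from krein_solution[OF w(2) this, of h]
  show "(resolvent A0 w h - \<gamma> w (B1 (inv (W w) (B2 (cadjoint (\<gamma> (cnj w)) h)))), h)
      \<in> op_shift AB w"
    \<comment> \<open>The adjoint of \<open>\<gamma> (cnj w)\<close> is the map
      \<open>\<Gamma>1 (resolvent A0 w h)\<close> occurring in the explicit solution.\<close>
    by (simp only: cadjoint_gamma[OF w(2)])
qed

end

theorem theorem2p14:
  fixes S A :: "'h::chilbert_space op"
    and \<Gamma>0 \<Gamma>1 :: "'h \<Rightarrow> 'g::chilbert_space"
    and B :: "'g \<Rightarrow> 'g"
    and B1 :: "'k::chilbert_space \<Rightarrow> 'g"
    and B2 :: "'g \<Rightarrow> 'k"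
  assumes "generalized_boundary_triple S A \<Gamma>0 \<Gamma>1"
    and "compact_operator B" and "cadjoint B = B"
    and "bounded_clinear B1" and "bounded_clinear B2"
    and "B = B1 \<circ> B2"
  shows "self_adjoint (op_AB A \<Gamma>0 \<Gamma>1 B)
    \<and> (\<forall>w \<in> resolvent_set (op_A0 A \<Gamma>0).
          op_ker (op_shift (op_AB A \<Gamma>0 \<Gamma>1 B) w)
            = (gamma_field A \<Gamma>0 w \<circ> B1) ` op_ker (op_of_fun (weyl_perturbation A \<Gamma>0 \<Gamma>1 B1 B2 w))
        \<and> (w \<in> point_spectrum (op_AB A \<Gamma>0 \<Gamma>1 B)
            \<longleftrightarrow> 0 \<in> point_spectrum (op_of_fun (weyl_perturbation A \<Gamma>0 \<Gamma>1 B1 B2 w))))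
    \<and> (\<forall>w \<in> resolvent_set (op_A0 A \<Gamma>0) - point_spectrum (op_AB A \<Gamma>0 \<Gamma>1 B).
          boundedly_invertible (weyl_perturbation A \<Gamma>0 \<Gamma>1 B1 B2 w))
    \<and> resolvent_set (op_A0 A \<Gamma>0) - point_spectrum (op_AB A \<Gamma>0 \<Gamma>1 B)
        = resolvent_set (op_A0 A \<Gamma>0) \<inter> resolvent_set (op_AB A \<Gamma>0 \<Gamma>1 B)
    \<and> (\<forall>w \<in> resolvent_set (op_AB A \<Gamma>0 \<Gamma>1 B) \<inter> resolvent_set (op_A0 A \<Gamma>0).
          resolvent (op_AB A \<Gamma>0 \<Gamma>1 B) w
            = (\<lambda>h. resolvent (op_A0 A \<Gamma>0) w h
                - gamma_field A \<Gamma>0 w (B1 (inv (weyl_perturbation A \<Gamma>0 \<Gamma>1 B1 B2 w)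
                    (B2 (cadjoint (gamma_field A \<Gamma>0 (cnj w)) h))))))"
proof -
  have "bounded_clinear B" using assms(2) by (simp add: compact_operator_def)
  \<comment> \<open>Boundedness makes \<open>cadjoint B\<close> a genuine adjoint, so
    \<open>cadjoint B = B\<close> yields symmetry.\<close>
  then have B: "cinner (B \<phi>) \<psi> = cinner \<phi> (B \<psi>)" for \<phi> \<psi>
    using cinner_cadjoint[of B] assms(3) by simp
  interpret perturbed_boundary_triple A \<Gamma>0 \<Gamma>1 B1 B2
  proof
    show "cinner (B1 (B2 \<phi>)) \<psi> = cinner \<phi> (B1 (B2 \<psi>))" for \<phi> \<psi>
      using B[of \<phi> \<psi>] assms(6) by simp
    show "compact_operator (B1 \<circ> B2)" using assms(2,6) by simp
  qed (use assms(1,4,5) in \<open>auto simp: generalized_boundary_triple_def\<close>)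
  \<comment> \<open>Off the point spectrum the resolvent of \<open>AB\<close> exists by the explicit
    solution; conversely a resolvent set contains no eigenvalues.\<close>
  have "resolvent_set A0 - point_spectrum AB = resolvent_set A0 \<inter> resolvent_set AB"
    using in_resolvent_set_AB not_in_point_spectrum_if_resolvent_set[OF op_AB] by blast
  moreover have "\<forall>w \<in> resolvent_set AB \<inter> resolvent_set A0. resolvent AB w
      = (\<lambda>h. resolvent A0 w h - \<gamma> w (B1 (inv (W w) (B2 (cadjoint (\<gamma> (cnj w)) h)))))"
    using resolvent_AB by blast
  ultimately show ?thesis
    unfolding assms(6)
    using self_adjoint_AB ker_AB point_spectrum_AB_iff boundedly_invertible_W by blast
qed

end
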